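(* Let $d\ge 2$ be an integer and let $e$ be an integer satisfying $2\le e\le\frac{d+3}{2}$. Then there is at least one abelian group $G$ of order $2^{2d+2}$, rank $d+1$, and exponent $2^e$, such that there is a reduced linking system of $(v,k,\lambda,n)$-difference sets in $G$ of size $7$, where $$(v,k,\lambda,n)=\big(2^{2d+2},\ 2^d(2^{d+1}-1),\ 2^d(2^d-1),\ 2^{2d}\big).$$
   Context: Groups are written multiplicatively. The rank of a finite abelian $2$-group is its minimal number of generators (the number of nontrivial cyclic factors in its decomposition as a direct product of cyclic groups). Difference set: let $G$ be a group of order $v$ and let $D$ be a subset of $G$ with $k$ elements. Then $D$ is a $(v,k,\lambda,n)$-difference set in $G$ if the multiset $\{d_1d_2^{-1}: d_1,d_2\in D,\ d_1\ne d_2\}$ contains every non-identity element of $G$ exactly $\lambda$ times and, by convention, $n=k-\lambda$. Reduced linking system: let $G$ be a group of order $v$ and let $\ell\ge 2$. Suppose $\mathcal{R}=\{D_1,D_2,\dots,D_\ell\}$ is a collection of size $\ell$ of $(v,k,\lambda,n)$-difference sets in $G$. Then $\mathcal{R}$ is a reduced $(v,k,\lambda,n;\ell)$-linking system of difference sets in $G$ of size $\ell$ (also called a reduced linking system of $(v,k,\lambda,n)$-difference sets in $G$ of size $\ell$) if there are integers $\mu,\nu$ such that for all distinct $i,j$ there is some $(v,k,\lambda,n)$-difference set $D(i,j)$ in $G$ satisfying, in the group ring $\mathbb{Z}[G]$, $$\sum_{d_i\in D_i}d_i\sum_{d_j\in D_j}d_j^{-1}=(\mu-\nu)\sum_{d\in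 D(i,j)}d+\nu\sum_{g\in G}g.$$ *)

theory Defs
  imports "HOL-Algebra.Algebra" "HOL-Library.Multiset" "HOL-Library.Poly_Mapping"
begin

definition group_rank :: "('a, 'b) monoid_scheme \<Rightarrow> nat" where
  "group_rank G =
     (LEAST r. \<exists>S. S \<subseteq> carrier G \<and> finite S \<and> card S = r \<and> generate G S = carrier G)"

definition group_exponent :: "('a, 'b) monoid_scheme \<Rightarrow> nat" where
  "group_exponent G = (LEAST m. 0 < m \<and> (\<forall>x\<in>carrier G. x [^]\<^bsub>G\<^esub> m = \<one>\<^bsub>G\<^esub>))"

text \<open>
  The parameter \<open>n\<close> is an integer so that \<open>n = k - l\<close> is genuine subtraction.
\<close>
definition difference_set ::
  "('a, 'b) monoid_scheme \<Rightarrow> nat \<Rightarrow> nat \<Rightarrow> nat \<Rightarrow> int \<Rightarrow> 'a set \<Rightarrow> bool" where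
  "difference_set G v k l n D \<longleftrightarrow>
     group G \<and> finite (carrier G) \<and> order G = v \<and>
     D \<subseteq> carrier G \<and> card D = k \<and>
     (\<forall>g \<in> carrier G - {\<one>\<^bsub>G\<^esub>}.
        count {# d1 \<otimes>\<^bsub>G\<^esub> inv\<^bsub>G\<^esub> d2. (d1, d2) \<in># mset_set {(d1, d2). d1 \<in> D \<and> d2 \<in> D \<and> d1 \<noteq> d2} #} g = l) \<and>
     n = int k - int l"

text \<open>
  An element of \<open>\<int>[G]\<close> is a finitely supported map \<open>'a \<Rightarrow>\<^sub>0 int\<close> (a formal integer combination
  of group elements), with \<open>frag_of g\<close> the basis element \<open>g\<close>, \<open>+\<close> the type-class addition and
  \<open>frag_cmul\<close> the multiplication by an integer.  The product is the bilinear extension of the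
  group operation; it is not the type-class product on \<open>\<Rightarrow>\<^sub>0\<close>, since \<open>G\<close> is a record and
  not a type-class group.
\<close>
definition group_ring_mult ::
  "('a, 'b) monoid_scheme \<Rightarrow> ('a \<Rightarrow>\<^sub>0 int) \<Rightarrow> ('a \<Rightarrow>\<^sub>0 int) \<Rightarrow> ('a \<Rightarrow>\<^sub>0 int)" where
  "group_ring_mult G a b =
     (\<Sum>x\<in>Poly_Mapping.keys a. \<Sum>y\<in>Poly_Mapping.keys b.
        frag_cmul (Poly_Mapping.lookup a x * Poly_Mapping.lookup b y) (frag_of (x \<otimes>\<^bsub>G\<^esub> y)))"

definition reduced_linking_system ::
  "('a, 'b) monoid_scheme \<Rightarrow> nat \<Rightarrow> nat \<Rightarrow> nat \<Rightarrow> int \<Rightarrow> nat \<Rightarrow> 'a set set \<Rightarrow> bool" where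
  "reduced_linking_system G v k l n L R \<longleftrightarrow>
     group G \<and> finite (carrier G) \<and> order G = v \<and> 2 \<le> L \<and>
     finite R \<and> card R = L \<and> (\<forall>D\<in>R. difference_set G v k l n D) \<and>
     (\<exists>\<mu> \<nu> :: int. \<forall>Di\<in>R. \<forall>Dj\<in>R. Di \<noteq> Dj \<longrightarrow>
        (\<exists>Dij. difference_set G v k l n Dij \<and>
           group_ring_mult G (\<Sum>d\<in>Di. frag_of d) (\<Sum>d\<in>Dj. frag_of (inv\<^bsub>G\<^esub> d)) =
             frag_cmul (\<mu> - \<nu>) (\<Sum>d\<in>Dij. frag_of d) + frag_cmul \<nu> (\<Sum>g\<in>carrier G. frag_of g)))"

end

theory Submission
  imports Defs
begin

text \<open>
  Put \<open>n = d + 1\<close> and \<open>f = e - 1\<close>, so that \<open>n \<ge> 3\<close>, \<open>f \<ge> 1\<close> and \<open>2 f \<le> n\<close>.  The group is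
  a product \<open>G\<close> of \<open>n\<close> cyclic \<open>2\<close>-groups of orders \<open>2\<^bsup>b k + 1\<^esup>\<close>, where the \<open>b k\<close> have sum
  \<open>n\<close> and maximum \<open>f\<close>.  Let \<open>E\<close> be its subgroup of elements of order at most two, which is
  elementary abelian of order \<open>2\<^sup>n\<close>, and let \<open>Q = G/E\<close>, also of order \<open>2\<^sup>n\<close>.

  The subgroups \<open>H\<^sub>u\<close> of index two in \<open>E\<close> are as many as the nontrivial elements of \<open>Q\<close>.  If
  \<open>g\<close> assigns to each \<open>u\<close> an element of its own nontrivial coset of \<open>E\<close>, then
  \<open>D(g) = \<Union>\<^sub>u g\<^sub>u H\<^sub>u\<close> is a McFarland--Dillon difference set with the required parameters.  Since
  \<open>H\<^sub>u H\<^sub>v\<close> is a multiple of \<open>E\<close> in the group ring for \<open>u \<noteq> v\<close>, only the terms \<open>u = v\<close> of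
  \<open>D(g) D(h)\<^sup>-\<^sup>1\<close> are not constant on cosets of \<open>E\<close>, and they are multiples of
  \<open>g\<^sub>u h\<^sub>u\<^sup>-\<^sup>1 H\<^sub>u\<close>.  If \<open>g h\<^sup>-\<^sup>1\<close> again takes values in pairwise different nontrivial cosets, then
  \<open>D(g) D(h)\<^sup>-\<^sup>1 = - 2\<^sup>d D' + 2\<^bsup>d - 1\<^esup> (2\<^bsup>d + 1\<^esup> - 1) G\<close>,
  where \<open>D'\<close> is the union of the sets \<open>g\<^sub>u h\<^sub>u\<^sup>-\<^sup>1 (E - H\<^sub>u)\<close>, another McFarland--Dillon
  difference set.  This is the linking condition.

  So seven functions \<open>g\<close> are needed whose values and pairwise quotients are bijections onto the
  nontrivial elements of \<open>Q\<close>; with a constant row they form a difference matrix over \<open>Q\<close> with eight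
  rows.  Such a matrix is obtained from a \<open>3 \<times> n\<close> array of elements of \<open>Q\<close> by summing over subsets
  of rows and columns, provided that no combination \<open>\<Sum> c\<^sub>i \<delta>\<^sub>j A\<^sub>i\<^sub>j\<close> with nonzero sign vectors
  \<open>c\<close> and \<open>\<delta>\<close> vanishes (\<open>zero_free\<close>).  Arrays for a subgroup and for the quotient by it can be
  put side by side (\<open>zero_free_extension\<close>), so arrays for all pairs \<open>(n, f)\<close> arise from six small
  ones, for \<open>(3,1)\<close>, \<open>(4,1)\<close>, \<open>(5,1)\<close>, \<open>(4,2)\<close>, \<open>(5,2)\<close> and \<open>(6,3)\<close>, which are verified by
  evaluation.
\<close>

section \<open>Contracted difference matrices over abelian 2-groups\<close>

text \<open>
  The array \<open>A\<close> is a \<^emph>\<open>contracted difference matrix\<close> with three rows over the group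
  \<open>Q = \<Prod>\<^sub>k \<int>/2\<^bsup>b k\<^esup>\<close>: the entry in row \<open>i\<close> and column \<open>j\<close> is the vector with
  coordinates \<open>A i j k\<close>.  The sums of its entries over subsets of rows and subsets of columns form an
  \<open>8 \<times> 2\<^sup>n\<close> matrix.  A difference of two \<open>0/1\<close>-vectors has entries in \<open>{-1, 0, 1}\<close>, so
  the condition says that in the difference of two distinct rows of the large matrix no element of
  \<open>Q\<close> is repeated.  If \<open>Q\<close> has order \<open>2\<^sup>n\<close>, each element then occurs exactly once,
  which is the defining property of a difference matrix.
\<close>
definition zero_free :: "nat \<Rightarrow> (nat \<Rightarrow> nat) \<Rightarrow> (nat \<Rightarrow> nat \<Rightarrow> nat \<Rightarrow> int) \<Rightarrow> bool" where
  "zero_free n b A \<longleftrightarrow>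
     (\<forall>c \<delta>. (\<forall>i<3. c i \<in> {-1, 0, 1}) \<and> (\<exists>i<3. c i \<noteq> 0) \<and>
            (\<forall>j<n. \<delta> j \<in> {-1, 0, 1}) \<and> (\<exists>j<n. \<delta> j \<noteq> 0) \<longrightarrow>
        (\<exists>k. \<not> 2 ^ b k dvd (\<Sum>i<3. \<Sum>j<n. c i * \<delta> j * A i j k)))"

lemma zero_freeI:
  assumes "\<And>c \<delta>. \<lbrakk>\<And>i. i < 3 \<Longrightarrow> c i \<in> {-1, 0, 1}; \<exists>i<3. c i \<noteq> 0;
                  \<And>j. j < n \<Longrightarrow> \<delta> j \<in> {-1, 0, 1};
                  \<And>k. 2 ^ b k dvd (\<Sum>i<3. \<Sum>j<n. c i * \<delta> j * A i j k)\<rbrakk>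
                 \<Longrightarrow> \<forall>j<n. \<delta> j = 0"
  shows "zero_free n b A"
  unfolding zero_free_def using assms by blast

lemma zero_freeD:
  assumes "zero_free n b A"
    and "\<And>i. i < 3 \<Longrightarrow> c i \<in> {-1, 0, 1}" "\<exists>i<3. c i \<noteq> 0"
    and "\<And>j. j < n \<Longrightarrow> \<delta> j \<in> {-1, 0, 1}"
    and "\<And>k. 2 ^ b k dvd (\<Sum>i<3. \<Sum>j<n. c i * \<delta> j * A i j k)"
  shows "\<forall>j<n. \<delta> j = 0"
  using assms unfolding zero_free_def by blast

text \<open>
  Some group \<open>\<Prod>\<^sub>k \<int>/2\<^bsup>b k\<^esup>\<close> of order \<open>2\<^sup>n\<close> and exponent \<open>2\<^sup>f\<close> carries a contracted
  difference matrix.  The exponents are padded with zeros from \<open>n\<close> on, and a largest one is put first.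
\<close>
definition admissible :: "nat \<Rightarrow> nat \<Rightarrow> bool" where
  "admissible n f \<longleftrightarrow>
     (\<exists>b A. (\<Sum>k<n. b k) = n \<and> (\<forall>k\<ge>n. b k = 0) \<and> (\<forall>k. b k \<le> f) \<and> b 0 = f \<and>
            zero_free n b A)"

lemma sum_append:
  fixes F :: "nat \<Rightarrow> int"
  shows "(\<Sum>j<m + n. F j) = (\<Sum>j<m. F j) + (\<Sum>j<n. F (m + j))"
  by (induction n) auto

text \<open>
  A matrix over a quotient \<open>Q/K\<close>, lifted to \<open>Q\<close>, can be placed next to a matrix over \<open>K\<close>.  Here
  \<open>K\<close> is the image of multiplication by \<open>2\<^bsup>a k\<^esup>\<close> in coordinate \<open>k\<close>.  A combination of the columns
  that vanishes in \<open>Q\<close> vanishes modulo \<open>K\<close>, so the coefficients of the first block are zero; what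
  is left is a vanishing combination in \<open>K\<close>.  Exponents of the two groups add up.
\<close>
lemma zero_free_extension:
  assumes A: "zero_free m a A" and B: "zero_free n b B"
  shows "zero_free (m + n) (\<lambda>k. a k + b k)
           (\<lambda>i j k. if j < m then A i j k else 2 ^ a k * B i (j - m) k)"
proof (rule zero_freeI)
  fix c \<delta> :: "nat \<Rightarrow> int"
  assume c: "\<And>i. i < 3 \<Longrightarrow> c i \<in> {-1, 0, 1}" "\<exists>i<3. c i \<noteq> 0"
    and \<delta>: "\<And>j. j < m + n \<Longrightarrow> \<delta> j \<in> {-1, 0, 1}"
    and dvd: "\<And>k. 2 ^ (a k + b k) dvd
      (\<Sum>i<3. \<Sum>j<m + n. c i * \<delta> j * (if j < m then A i j k else 2 ^ a k * B i (j - m) k))"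
  define SA where "SA = (\<lambda>k. \<Sum>i<3. \<Sum>j<m. c i * \<delta> j * A i j k)"
  define SB where "SB = (\<lambda>k. \<Sum>i<3. \<Sum>j<n. c i * \<delta> (m + j) * B i j k)"
  have split: "(\<Sum>i<3. \<Sum>j<m + n. c i * \<delta> j * (if j < m then A i j k else 2 ^ a k * B i (j - m) k))
      = SA k + 2 ^ a k * SB k" for k
    by (simp add: SA_def SB_def sum_append sum.distrib sum_distrib_left algebra_simps)
  have dvd': "2 ^ a k * 2 ^ b k dvd SA k + 2 ^ a k * SB k" for k
    using dvd[of k] unfolding split by (simp add: power_add)
  have "2 ^ a k dvd SA k" for k
    using dvd_mult_left[OF dvd'[of k]] by (simp add: dvd_add_left_iff)
  then have 1: "\<forall>j<m. \<delta> j = 0"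
    unfolding SA_def by (intro zero_freeD[OF A c, of \<delta>] \<delta>) simp_all
  then have "SA k = 0" for k
    by (simp add: SA_def)
  then have "2 ^ b k dvd SB k" for k
    using dvd'[of k] by simp
  then have 2: "\<forall>j<n. \<delta> (m + j) = 0"
    unfolding SB_def by (intro zero_freeD[OF B c, of "\<lambda>j. \<delta> (m + j)"] \<delta>) simp_all
  show "\<forall>j<m + n. \<delta> j = 0"
  proof (intro allI impI)
    fix j assume "j < m + n"
    then show "\<delta> j = 0"
      using 1 2[rule_format, of "j - m"] by (cases "j < m") auto
  qed
qed

text \<open>
  Moving a matrix to fresh coordinates turns the extension above into a direct product, in which
  exponents do not add up.
\<close>
lemma zero_free_shift:
  assumes "zero_free n b B"
  shows "zero_free n (\<lambda>k. if k < m then 0 else b (k - m)) (\<lambda>i j k. B i j (k - m))"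
proof (rule zero_freeI)
  fix c \<delta> :: "nat \<Rightarrow> int"
  assume c: "\<And>i. i < 3 \<Longrightarrow> c i \<in> {-1, 0, 1}" "\<exists>i<3. c i \<noteq> 0"
    and \<delta>: "\<And>j. j < n \<Longrightarrow> \<delta> j \<in> {-1, 0, 1}"
    and dvd: "\<And>k. 2 ^ (if k < m then 0 else b (k - m)) dvd
      (\<Sum>i<3. \<Sum>j<n. c i * \<delta> j * B i j (k - m))"
  show "\<forall>j<n. \<delta> j = 0"
  proof (rule zero_freeD[OF assms c \<delta>])
    show "2 ^ b k dvd (\<Sum>i<3. \<Sum>j<n. c i * \<delta> j * B i j k)" for k
      using dvd[of "k + m"] by simp
  qed
qed

lemma admissible_extension:
  assumes "admissible m f" "admissible n g"
  shows "admissible (m + n) (f + g)"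
proof -
  obtain a A where a: "(\<Sum>k<m. a k) = m" "\<forall>k\<ge>m. a k = 0" "\<forall>k. a k \<le> f" "a 0 = f"
      and A: "zero_free m a A"
    using assms(1) unfolding admissible_def by blast
  obtain b B where b: "(\<Sum>k<n. b k) = n" "\<forall>k\<ge>n. b k = 0" "\<forall>k. b k \<le> g" "b 0 = g"
      and B: "zero_free n b B"
    using assms(2) unfolding admissible_def by blast
  have "(\<Sum>k<m + n. a k) = (\<Sum>k<m. a k)" "(\<Sum>k<m + n. b k) = (\<Sum>k<n. b k)"
    using a(2) b(2) by (simp_all add: sum.mono_neutral_right)
  then have "(\<Sum>k<m + n. a k + b k) = m + n"
    using a(1) b(1) by (simp add: sum.distrib)
  moreover have "a k + b k \<le> f + g" for k
    using a(3) b(3) by (simp add: add_mono)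
  ultimately show ?thesis
    unfolding admissible_def using zero_free_extension[OF A B] a b
    by (intro exI[of _ "\<lambda>k. a k + b k"] exI) auto
qed

lemma admissible_sum:
  assumes "admissible m f" "admissible n g" "g \<le> f" "0 < m"
  shows "admissible (m + n) f"
proof -
  obtain a A where a: "(\<Sum>k<m. a k) = m" "\<forall>k\<ge>m. a k = 0" "\<forall>k. a k \<le> f" "a 0 = f"
      and A: "zero_free m a A"
    using assms(1) unfolding admissible_def by blast
  obtain b B where b: "(\<Sum>k<n. b k) = n" "\<forall>k\<ge>n. b k = 0" "\<forall>k. b k \<le> g" "b 0 = g"
      and B: "zero_free n b B"
    using assms(2) unfolding admissible_def by blast
  define b' where "b' = (\<lambda>k. if k < m then 0 else b (k - m))"
  have "(\<Sum>k<m + n. a k) = (\<Sum>k<m. a k)"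
    using a(2) by (simp add: sum.mono_neutral_right)
  moreover have "(\<Sum>k<m + r. b' k) = (\<Sum>k<r. b k)" for r
    by (induction r) (auto simp: b'_def)
  ultimately have "(\<Sum>k<m + n. a k + b' k) = m + n"
    using a(1) b(1) by (simp add: sum.distrib)
  moreover have "a k + b' k \<le> f" for k
    using a(2,3) b(3) \<open>g \<le> f\<close> by (cases "k < m") (auto simp: b'_def intro: order_trans)
  moreover have "a k + b' k = 0" if "k \<ge> m + n" for k
    using that a(2) b(2) by (simp add: b'_def)
  moreover have "a 0 + b' 0 = f"
    using a(4) \<open>0 < m\<close> by (simp add: b'_def)
  moreover have "\<exists>A'. zero_free (m + n) (\<lambda>k. a k + b' k) A'"
    unfolding b'_def using zero_free_extension[OF A zero_free_shift[OF B]] by blast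
  ultimately show ?thesis
    unfolding admissible_def by (intro exI[of _ "\<lambda>k. a k + b' k"]) blast
qed

text \<open>
  Decision procedure for the defining condition of a contracted difference matrix.  The signed sums
  are enumerated depth first instead of being collected in a list, because symbolic evaluation slows
  down badly on large intermediate terms.
\<close>
fun avoids_zero :: "int list \<Rightarrow> int list \<Rightarrow> int list list \<Rightarrow> bool" where
  "avoids_zero ms w [] \<longleftrightarrow> list_ex (\<lambda>(m, x). x mod m \<noteq> 0) (zip ms w)"
| "avoids_zero ms w (v # vs) \<longleftrightarrow>
     avoids_zero ms w vs \<and> avoids_zero ms (map2 (+) w v) vs \<and> avoids_zero ms (map2 (-) w v) vs"

text \<open>
  Negation preserves vanishing, so the first nonzero coefficient may be taken to be \<open>1\<close>.
\<close>
fun sign_independent :: "int list \<Rightarrow> int list list \<Rightarrow> bool" where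
  "sign_independent ms [] \<longleftrightarrow> True"
| "sign_independent ms (v # vs) \<longleftrightarrow> avoids_zero ms v vs \<and> sign_independent ms vs"

lemma avoids_zeroD:
  assumes "avoids_zero ms w vs" "length w = length ms" "\<And>v. v \<in> set vs \<Longrightarrow> length v = length ms"
    and "\<And>j. j < length vs \<Longrightarrow> \<delta> j \<in> {-1, 0, 1}"
  shows "\<exists>k<length ms. \<not> ms ! k dvd w ! k + (\<Sum>j<length vs. \<delta> j * vs ! j ! k)"
  using assms
proof (induction vs arbitrary: w \<delta>)
  case Nil
  then show ?case
    by (auto simp: list_ex_iff in_set_zip dvd_eq_mod_eq_0)
next
  case (Cons v vs)
  define w' where "w' = (if \<delta> 0 = 0 then w else if \<delta> 0 = 1 then map2 (+) w v else map2 (-) w v)"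
  have len: "length w = length ms" "length v = length ms"
    using Cons.prems by auto
  have w': "w' ! k = w ! k + \<delta> 0 * v ! k" if "k < length ms" for k
    using that len Cons.prems(4)[of 0] by (auto simp: w'_def)
  have "\<exists>k<length ms. \<not> ms ! k dvd w' ! k + (\<Sum>j<length vs. \<delta> (Suc j) * vs ! j ! k)"
  proof (rule Cons.IH)
    show "avoids_zero ms w' vs" "length w' = length ms"
      using Cons.prems(1) len by (auto simp: w'_def)
    show "\<delta> (Suc j) \<in> {-1, 0, 1}" if "j < length vs" for j
      using Cons.prems(4)[of "Suc j"] that by simp
  qed (use Cons.prems in auto)
  then show ?case
    by (auto simp: w' sum.lessThan_Suc_shift algebra_simps simp del: sum.lessThan_Suc)
qed

lemma sign_independentD:
  assumes "sign_independent ms vs" "\<And>v. v \<in> set vs \<Longrightarrow> length v = length ms"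
    and "\<And>j. j < length vs \<Longrightarrow> \<delta> j \<in> {-1, 0, 1}"
    and "\<And>k. k < length ms \<Longrightarrow> ms ! k dvd (\<Sum>j<length vs. \<delta> j * vs ! j ! k)"
  shows "\<forall>j<length vs. \<delta> j = 0"
  using assms
proof (induction vs arbitrary: \<delta>)
  case Nil
  then show ?case by simp
next
  case (Cons v vs)
  have split: "(\<Sum>j<length (v # vs). \<delta> j * (v # vs) ! j ! k) =
      \<delta> 0 * v ! k + (\<Sum>j<length vs. \<delta> (Suc j) * vs ! j ! k)" for k
    by (simp add: sum.lessThan_Suc_shift del: sum.lessThan_Suc)
  have sign: "\<delta> (Suc j) \<in> {-1, 0, 1}" if "j < length vs" for j
    using Cons.prems(3)[of "Suc j"] that by simp
  have zero: "\<delta> 0 = 0"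
  proof (rule ccontr)
    assume "\<delta> 0 \<noteq> 0"
    \<comment> \<open>Multiplying the combination by \<open>\<delta> 0\<close> makes its leading coefficient \<open>1\<close>.\<close>
    then have s: "\<delta> 0 * \<delta> 0 = 1"
      using Cons.prems(3)[of 0] by auto
    have "\<exists>k<length ms. \<not> ms ! k dvd v ! k + (\<Sum>j<length vs. (\<delta> 0 * \<delta> (Suc j)) * vs ! j ! k)"
    proof (rule avoids_zeroD)
      show "\<delta> 0 * \<delta> (Suc j) \<in> {-1, 0, 1}" if "j < length vs" for j
        using sign[OF that] Cons.prems(3)[of 0] by auto
    qed (use Cons.prems in auto)
    then obtain k where k: "k < length ms"
      "\<not> ms ! k dvd v ! k + (\<Sum>j<length vs. (\<delta> 0 * \<delta> (Suc j)) * vs ! j ! k)"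
      by blast
    have "v ! k + (\<Sum>j<length vs. (\<delta> 0 * \<delta> (Suc j)) * vs ! j ! k) =
        \<delta> 0 * (\<Sum>j<length (v # vs). \<delta> j * (v # vs) ! j ! k)"
      unfolding split distrib_left sum_distrib_left mult.assoc[symmetric] s by simp
    then show False
      using k Cons.prems(4)[OF k(1)] by simp
  qed
  have "\<forall>j<length vs. \<delta> (Suc j) = 0"
  proof (rule Cons.IH)
    show "ms ! k dvd (\<Sum>j<length vs. \<delta> (Suc j) * vs ! j ! k)" if "k < length ms" for k
      using Cons.prems(4)[OF that] unfolding split zero by simp
  qed (use Cons.prems sign in auto)
  with zero show ?case
    by (auto simp: less_Suc_eq_0_disj)
qed

definition combine_rows :: "nat \<Rightarrow> nat \<Rightarrow> int list list list \<Rightarrow> int \<times> int \<times> int \<Rightarrow> int list list" where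
  "combine_rows n K M = (\<lambda>(x, y, z).
     map (\<lambda>j. map (\<lambda>k. x * M ! 0 ! j ! k + y * M ! 1 ! j ! k + z * M ! 2 ! j ! k) [0..<K]) [0..<n])"

text \<open>
  The nonzero sign vectors of length three, one from each pair \<open>{c, -c}\<close>.
\<close>
definition sign_triples :: "(int \<times> int \<times> int) list" where
  "sign_triples =
     [(0, 0, 1), (0, 1, -1), (0, 1, 0), (0, 1, 1),
      (1, -1, -1), (1, -1, 0), (1, -1, 1), (1, 0, -1), (1, 0, 0), (1, 0, 1),
      (1, 1, -1), (1, 1, 0), (1, 1, 1)]"

definition check_zero_free :: "nat list \<Rightarrow> int list list list \<Rightarrow> bool" where
  "check_zero_free bs M \<longleftrightarrow>
     list_all (\<lambda>c. sign_independent (map (\<lambda>b. 2 ^ b) bs) (combine_rows (sum_list bs) (length bs) M c))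
       sign_triples"

lemma sign_triples_complete:
  assumes "x \<in> {-1, 0, 1}" "y \<in> {-1, 0, 1}" "z \<in> {-1, 0, 1}" "(x, y, z) \<noteq> (0, 0, 0)"
  shows "\<exists>s. s * s = 1 \<and> (s * x, s * y, s * z) \<in> set sign_triples"
proof -
  have "(x, y, z) \<in> set sign_triples \<or> (- x, - y, - z) \<in> set sign_triples"
    using assms by (elim insertE emptyE; simp add: sign_triples_def)
  then show ?thesis
    by (auto intro: exI[of _ 1] exI[of _ "-1"])
qed

lemma zero_free_if_check:
  assumes "check_zero_free bs M"
  shows "zero_free (sum_list bs) (\<lambda>k. if k < length bs then bs ! k else 0) (\<lambda>i j k. M ! i ! j ! k)"
    (is "zero_free ?n ?b ?A")
proof (rule zero_freeI)
  fix c \<delta> :: "nat \<Rightarrow> int"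
  assume c: "\<And>i. i < 3 \<Longrightarrow> c i \<in> {-1, 0, 1}" "\<exists>i<3. c i \<noteq> 0"
    and \<delta>: "\<And>j. j < ?n \<Longrightarrow> \<delta> j \<in> {-1, 0, 1}"
    and dvd: "\<And>k. 2 ^ ?b k dvd (\<Sum>i<3. \<Sum>j<?n. c i * \<delta> j * M ! i ! j ! k)"
  have "c 0 \<in> {-1, 0, 1}" "c 1 \<in> {-1, 0, 1}" "c 2 \<in> {-1, 0, 1}"
    using c(1)[of 0] c(1)[of 1] c(1)[of 2] by simp_all
  moreover have "(c 0, c 1, c 2) \<noteq> (0, 0, 0)"
    using c(2) by (auto simp: numeral_3_eq_3 less_Suc_eq numeral_2_eq_2)
  ultimately obtain s where s: "s * s = 1" "(s * c 0, s * c 1, s * c 2) \<in> set sign_triples"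
    using sign_triples_complete by blast
  \<comment> \<open>Changing the signs of \<open>c\<close> and \<open>\<delta>\<close> together leaves the combination unchanged.\<close>
  define vs where "vs = combine_rows ?n (length bs) M (s * c 0, s * c 1, s * c 2)"
  have len: "length vs = ?n" "\<And>v. v \<in> set vs \<Longrightarrow> length v = length bs"
    by (auto simp: vs_def combine_rows_def)
  have "\<forall>j<length vs. s * \<delta> j = 0"
  proof (rule sign_independentD)
    show "sign_independent (map (\<lambda>b. 2 ^ b) bs) vs"
      using assms s(2) unfolding check_zero_free_def vs_def list_all_iff by blast
    have "s = 1 \<or> s = -1"
      using s(1) by (simp add: zmult_eq_1_iff)
    then show "s * \<delta> j \<in> {-1, 0, 1}" if "j < length vs" for j
      using \<delta>[of j] that len(1) by auto
    show "map (\<lambda>b. 2 ^ b) bs ! k dvd (\<Sum>j<length vs. s * \<delta> j * vs ! j ! k)"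
      if "k < length (map (\<lambda>b. 2 ^ b) bs)" for k
    proof -
      have "s * \<delta> j * vs ! j ! k = (\<Sum>i<3. c i * \<delta> j * M ! i ! j ! k)" if "j < ?n" for j
      proof -
        have "s * \<delta> j * vs ! j ! k = (s * s) * (\<Sum>i<3. c i * \<delta> j * M ! i ! j ! k)"
          using that \<open>k < _\<close> by (simp add: vs_def combine_rows_def eval_nat_numeral algebra_simps)
        then show ?thesis
          by (simp add: s(1))
      qed
      then have "(\<Sum>j<length vs. s * \<delta> j * vs ! j ! k) = (\<Sum>i<3. \<Sum>j<?n. c i * \<delta> j * M ! i ! j ! k)"
        unfolding len(1) by (subst sum.swap) simp
      then show ?thesis
        using dvd[of k] that by simp
    qed
  qed (use len in auto)
  moreover have "s \<noteq> 0"
    using s(1) by auto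
  ultimately show "\<forall>j<?n. \<delta> j = 0"
    by (simp add: len(1))
qed

lemma admissible_if_check:
  assumes "check_zero_free bs M" "bs \<noteq> []" "length bs \<le> sum_list bs" "list_all (\<lambda>b. b \<le> hd bs) bs"
  shows "admissible (sum_list bs) (hd bs)"
proof -
  let ?b = "\<lambda>k. if k < length bs then bs ! k else 0"
  have "(\<Sum>k<sum_list bs. ?b k) = (\<Sum>k<length bs. ?b k)"
    using assms(3) by (intro sum.mono_neutral_right) auto
  also have "\<dots> = sum_list bs"
    by (simp add: sum_list_sum_nth atLeast0LessThan)
  finally show ?thesis
    unfolding admissible_def using assms zero_free_if_check[OF assms(1)]
    by (intro exI[of _ ?b] exI) (auto simp: list_all_length hd_conv_nth)
qed

section \<open>Matrices of small order and the range of exponents\<close>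

text \<open>
  Over \<open>\<int>/2\<close> a field with \<open>2\<^sup>n\<close> elements gives a contracted difference matrix: for a generator
  \<open>x\<close> let the entry in row \<open>i\<close> and column \<open>j\<close> be \<open>x\<^bsup>i + j\<^esup>\<close>, written in the basis
  \<open>1, x, \<dots>, x\<^bsup>n - 1\<^esup>\<close>.  The combination with coefficients \<open>c\<close> and \<open>\<delta>\<close> is the product of the
  field elements \<open>\<Sum> c\<^sub>i x\<^sup>i\<close> and \<open>\<Sum> \<delta>\<^sub>j x\<^sup>j\<close>, which are both nonzero.  The matrices for
  \<open>n = 3, 4, 5\<close> use \<open>x\<^sup>3 = x + 1\<close>, \<open>x\<^sup>4 = x + 1\<close> and \<open>x\<^sup>5 = x\<^sup>2 + 1\<close>.
\<close>
lemma admissible_3_1: "admissible 3 1"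
proof -
  have "check_zero_free [1, 1, 1]
      [[[1,0,0], [0,1,0], [0,0,1]],
       [[0,1,0], [0,0,1], [1,1,0]],
       [[0,0,1], [1,1,0], [0,1,1]]]"
    by code_simp
  from admissible_if_check[OF this] show ?thesis by (simp add: eval_nat_numeral)
qed

lemma admissible_4_1: "admissible 4 1"
proof -
  have "check_zero_free [1, 1, 1, 1]
      [[[1,0,0,0], [0,1,0,0], [0,0,1,0], [0,0,0,1]],
       [[0,1,0,0], [0,0,1,0], [0,0,0,1], [1,1,0,0]],
       [[0,0,1,0], [0,0,0,1], [1,1,0,0], [0,1,1,0]]]"
    by code_simp
  from admissible_if_check[OF this] show ?thesis by (simp add: eval_nat_numeral)
qed

lemma admissible_5_1: "admissible 5 1"
proof -
  have "check_zero_free [1, 1, 1, 1, 1]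
      [[[1,0,0,0,0], [0,1,0,0,0], [0,0,1,0,0], [0,0,0,1,0], [0,0,0,0,1]],
       [[0,1,0,0,0], [0,0,1,0,0], [0,0,0,1,0], [0,0,0,0,1], [1,0,1,0,0]],
       [[0,0,1,0,0], [0,0,0,1,0], [0,0,0,0,1], [1,0,1,0,0], [0,1,0,1,0]]]"
    by code_simp
  from admissible_if_check[OF this] show ?thesis by (simp add: eval_nat_numeral)
qed

text \<open>
  The next matrices live over \<open>\<int>/4 \<times> (\<int>/2)\<^sup>2\<close>, \<open>(\<int>/4)\<^sup>2 \<times> \<int>/2\<close> and
  \<open>\<int>/8 \<times> \<int>/4 \<times> \<int>/2\<close> and come from a computer search that adds one column at a time.  Extending
  one elementary abelian block by another does not give them: such a block has order at least \<open>8\<close>, so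
  two of them need order at least \<open>64\<close> and reach only exponent \<open>4\<close>.
\<close>
lemma admissible_4_2: "admissible 4 2"
proof -
  have "check_zero_free [2, 1, 1]
      [[[1,1,1], [0,1,1], [0,0,1], [2,0,1]],
       [[2,0,0], [1,1,1], [2,0,1], [2,1,1]],
       [[0,0,1], [2,0,0], [3,0,1], [2,1,0]]]"
    by code_simp
  from admissible_if_check[OF this] show ?thesis by (simp add: eval_nat_numeral)
qed

lemma admissible_5_2: "admissible 5 2"
proof -
  have "check_zero_free [2, 2, 1]
      [[[3,3,1], [2,3,0], [0,3,0], [0,0,1], [0,2,1]],
       [[1,2,0], [2,1,1], [1,2,1], [0,2,1], [2,0,0]],
       [[1,3,0], [3,1,1], [3,0,1], [2,2,0], [2,0,1]]]"
    by code_simp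
  from admissible_if_check[OF this] show ?thesis by (simp add: eval_nat_numeral)
qed

lemma admissible_6_3: "admissible 6 3"
proof -
  have "check_zero_free [3, 2, 1]
      [[[5,0,0], [7,2,1], [4,1,0], [0,2,0], [4,2,0], [6,2,0]],
       [[1,0,0], [6,3,0], [0,3,0], [6,1,1], [4,2,1], [0,0,1]],
       [[2,2,0], [4,1,0], [1,0,0], [4,2,0], [4,0,1], [4,2,1]]]"
    by code_simp
  from admissible_if_check[OF this] show ?thesis by (simp add: eval_nat_numeral)
qed

text \<open>
  Large cases reduce to the small ones: splitting off a group of order \<open>16\<close> and exponent \<open>4\<close>
  lowers \<open>n\<close> by four and \<open>f\<close> by two, so it preserves \<open>2 f \<le> n\<close>.  For \<open>f \<le> 2\<close> and
  \<open>n \<ge> 6\<close> an elementary abelian group of order \<open>8\<close> is split off instead.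
\<close>
lemma admissible_if_twice_le:
  assumes "3 \<le> n" "1 \<le> f" "2 * f \<le> n"
  shows "admissible n f"
  using assms
proof (induction n arbitrary: f rule: less_induct)
  case (less n)
  consider "f = 1" "n \<le> 5" | "f = 1" "6 \<le> n" | "f = 2" "n \<le> 5" | "f = 2" "6 \<le> n"
    | "3 \<le> f" "n = 6" | "3 \<le> f" "7 \<le> n"
    using less.prems by linarith
  then show ?case
  proof cases
    case 1
    then have "n = 3 \<or> n = 4 \<or> n = 5"
      using less.prems by linarith
    then show ?thesis
      using 1 admissible_3_1 admissible_4_1 admissible_5_1 by auto
  next
    case 2
    have "admissible (n - 3 + 3) 1"
      using 2 by (intro admissible_sum[OF less.IH admissible_3_1]) auto
    with 2 show ?thesis by simp
  next
    case 3
    then have "n = 4 \<or> n = 5"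
      using less.prems by linarith
    then show ?thesis
      using 3 admissible_4_2 admissible_5_2 by auto
  next
    case 4
    have "admissible (n - 3 + 3) (1 + 1)"
      using 4 by (intro admissible_extension[OF less.IH admissible_3_1]) auto
    with 4 show ?thesis
      by (simp add: numeral_2_eq_2)
  next
    case 5
    then have "f = 3"
      using less.prems by linarith
    with 5 show ?thesis
      using admissible_6_3 by simp
  next
    case 6
    have "admissible (n - 4 + 4) (f - 2 + 2)"
      using 6 less.prems by (intro admissible_extension[OF less.IH admissible_4_2]) auto
    moreover have "n - 4 + 4 = n" "f - 2 + 2 = f"
      using 6 by simp_all
    ultimately show ?thesis
      by (simp only:)
  qed
qed

section \<open>Difference sets from translated hyperplanes\<close>

text \<open>
  The \<open>\<chi> u\<close> are to be thought of as the nontrivial characters of an elementary abelian group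
  \<open>E\<close>, with \<open>True\<close> for the value \<open>-1\<close>.  Their kernels are then the subgroups of index two
  (the hyperplanes) of \<open>E\<close>.  The numbers fit together because \<open>E\<close> has as many nontrivial cosets in
  \<open>G\<close> as it has hyperplanes.
\<close>
locale hyperplane_family = comm_group G for G (structure) +
  fixes E :: "'a set" and U :: "'i set" and \<chi> :: "'i \<Rightarrow> 'a \<Rightarrow> bool" and d :: nat
  assumes d_pos: "1 \<le> d"
    and E: "subgroup E G"
    and card_E: "card E = 2 ^ (d + 1)"
    and order_G: "order G = 2 ^ (2 * d + 2)"
    and finite_U: "finite U"
    and card_U: "card U = 2 ^ (d + 1) - 1"
    and char_mult: "\<lbrakk>u \<in> U; x \<in> E; y \<in> E\<rbrakk> \<Longrightarrow> \<chi> u (x \<otimes> y) \<longleftrightarrow> (\<chi> u x \<noteq> \<chi> u y)"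
    and char_nontrivial: "u \<in> U \<Longrightarrow> \<exists>t\<in>E. \<chi> u t"
    and char_separate: "\<lbrakk>u \<in> U; v \<in> U; u \<noteq> v\<rbrakk> \<Longrightarrow> \<exists>t\<in>E. \<not> \<chi> u t \<and> \<chi> v t"
    and card_kernels: "\<lbrakk>x \<in> E; x \<noteq> \<one>\<rbrakk> \<Longrightarrow> card {u \<in> U. \<not> \<chi> u x} = 2 ^ d - 1"
begin

definition H :: "'i \<Rightarrow> 'a set" where
  "H u = {x \<in> E. \<not> \<chi> u x}"

text \<open>
  This is the McFarland--Dillon construction: each hyperplane is translated into a coset of its own.
\<close>
definition coset_union :: "('i \<Rightarrow> 'a) \<Rightarrow> 'a set" where
  "coset_union f = (\<Union>u\<in>U. (\<lambda>t. f u \<otimes> t) ` H u)"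

text \<open>
  By the choice of \<open>card U\<close>, such an \<open>f\<close> meets every nontrivial coset of \<open>E\<close> exactly once.
\<close>
definition transversal :: "('i \<Rightarrow> 'a) \<Rightarrow> bool" where
  "transversal f \<longleftrightarrow> (\<forall>u\<in>U. f u \<in> carrier G \<and> f u \<notin> E) \<and>
     (\<forall>u\<in>U. \<forall>v\<in>U. inv (f u) \<otimes> f v \<in> E \<longrightarrow> u = v)"

lemma finite_G: "finite (carrier G)"
  using order_G order_gt_0_iff_finite by simp

lemma E_carrier: "x \<in> E \<Longrightarrow> x \<in> carrier G"
  using E by (rule subgroup.mem_carrier)

lemma E_mult: "\<lbrakk>x \<in> E; y \<in> E\<rbrakk> \<Longrightarrow> x \<otimes> y \<in> E"
  using E by (rule subgroup.m_closed)

lemma E_inv: "x \<in> E \<Longrightarrow> inv x \<in> E"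
  using E by (rule subgroup.m_inv_closed)

lemma E_one: "\<one> \<in> E"
  using E by (rule subgroup.one_closed)

lemma finite_E: "finite E"
  using finite_G E_carrier by (meson finite_subset subsetI)

lemma E_cancel_right: "\<lbrakk>x \<in> carrier G; y \<in> E\<rbrakk> \<Longrightarrow> x \<otimes> y \<in> E \<longleftrightarrow> x \<in> E"
  by (metis E_carrier E_inv E_mult inv_closed m_assoc r_inv r_one)

lemma E_cancel_left: "\<lbrakk>x \<in> carrier G; y \<in> E\<rbrakk> \<Longrightarrow> y \<otimes> x \<in> E \<longleftrightarrow> x \<in> E"
  using E_cancel_right E_carrier m_comm by metis

lemma E_inv_iff: "x \<in> carrier G \<Longrightarrow> inv x \<in> E \<longleftrightarrow> x \<in> E"
  using E_inv by (metis inv_inv)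

lemma char_one: "u \<in> U \<Longrightarrow> \<not> \<chi> u \<one>"
  using char_mult[of u \<one> \<one>] E_one by simp

lemma char_inv: "\<lbrakk>u \<in> U; x \<in> E\<rbrakk> \<Longrightarrow> \<chi> u (inv x) \<longleftrightarrow> \<chi> u x"
  using char_mult[of u x "inv x"] char_one E_carrier E_inv by auto

lemma card_translate:
  assumes "t \<in> E" and "\<And>x. x \<in> E \<Longrightarrow> Q (t \<otimes> x) \<longleftrightarrow> P x"
  shows "card {x \<in> E. P x} = card {x \<in> E. Q x}"
proof (rule bij_betw_same_card)
  show "bij_betw (\<lambda>x. t \<otimes> x) {x \<in> E. P x} {x \<in> E. Q x}"
  proof (rule bij_betw_byWitness[where f' = "\<lambda>x. inv t \<otimes> x"])
    have "P (inv t \<otimes> x)" if "x \<in> E" "Q x" for x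
    proof -
      have "t \<otimes> (inv t \<otimes> x) = x"
        using assms(1) that(1) E_carrier by (simp add: m_assoc[symmetric])
      then show ?thesis
        using assms(2)[of "inv t \<otimes> x"] assms(1) that E_mult E_inv by simp
    qed
    then show "(\<lambda>x. inv t \<otimes> x) ` {x \<in> E. Q x} \<subseteq> {x \<in> E. P x}"
      using assms(1) E_mult E_inv by auto
  qed (use assms E_mult E_carrier in \<open>auto simp: m_assoc[symmetric]\<close>)
qed

lemma card_H: "u \<in> U \<Longrightarrow> card (H u) = 2 ^ d"
proof -
  assume u: "u \<in> U"
  obtain t where t: "t \<in> E" "\<chi> u t"
    using char_nontrivial[OF u] by blast
  have "card {x \<in> E. \<not> \<chi> u x} = card {x \<in> E. \<chi> u x}"
    by (rule card_translate[OF t(1)]) (use t u char_mult in auto)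
  moreover have "card E = card {x \<in> E. \<not> \<chi> u x} + card {x \<in> E. \<chi> u x}"
    using finite_E by (subst card_Un_disjoint[symmetric]) (auto intro: arg_cong[where f = card])
  ultimately show ?thesis
    using card_E by (simp add: H_def)
qed

text \<open>
  Translation by an element in the kernel of \<open>\<chi> v\<close> but not of \<open>\<chi> u\<close> exchanges the two halves of
  \<open>H v\<close> on which \<open>\<chi> u\<close> is constant.
\<close>
lemma card_H_translate_diff:
  assumes "u \<in> U" "v \<in> U" "u \<noteq> v" "y \<in> E"
  shows "card {t \<in> H v. y \<otimes> t \<in> H u} = 2 ^ (d - 1)"
proof -
  obtain s where s: "s \<in> E" "\<not> \<chi> v s" "\<chi> u s"
    using char_separate[of v u] assms by auto
  let ?C = "\<lambda>p. {t \<in> E. \<not> \<chi> v t \<and> (\<chi> u t \<longleftrightarrow> p)}"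
  have "card (?C False) = card (?C True)"
    by (rule card_translate[OF s(1)]) (use s assms char_mult in auto)
  moreover have "card (H v) = card (?C False) + card (?C True)"
    using finite_E by (subst card_Un_disjoint[symmetric]) (auto simp: H_def intro: arg_cong[where f = card])
  moreover have "(2::nat) ^ d = 2 * 2 ^ (d - 1)"
    using d_pos by (metis Suc_diff_1 One_nat_def Suc_le_eq power_Suc)
  ultimately have "card (?C p) = 2 ^ (d - 1)" for p
    using card_H[OF assms(2)] by (cases p) auto
  moreover have "{t \<in> H v. y \<otimes> t \<in> H u} = ?C (\<chi> u y)"
    using assms char_mult E_mult by (auto simp: H_def)
  ultimately show ?thesis
    by simp
qed

lemma card_H_translate_same:
  assumes "u \<in> U" "y \<in> E"
  shows "card {t \<in> H u. y \<otimes> t \<in> H u} = (if y \<in> H u then 2 ^ d else 0)"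
proof -
  have "{t \<in> H u. y \<otimes> t \<in> H u} = (if y \<in> H u then H u else {})"
    using assms char_mult E_mult by (auto simp: H_def)
  then show ?thesis
    using card_H[OF assms(1)] by simp
qed

lemma transversal_carrier: "\<lbrakk>transversal f; u \<in> U\<rbrakk> \<Longrightarrow> f u \<in> carrier G"
  by (simp add: transversal_def)

lemma transversal_not_E: "\<lbrakk>transversal f; u \<in> U\<rbrakk> \<Longrightarrow> f u \<notin> E"
  by (simp add: transversal_def)

lemma same_coset:
  assumes "x \<in> carrier G" "y \<in> carrier G" "z \<in> carrier G" "inv x \<otimes> z \<in> E" "inv y \<otimes> z \<in> E"
  shows "inv x \<otimes> y \<in> E"
proof -
  have "z \<otimes> (inv z \<otimes> y) = y"
    using assms(2,3) by (simp add: m_assoc[symmetric])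
  then have "inv x \<otimes> y = (inv x \<otimes> z) \<otimes> inv (inv y \<otimes> z)"
    using assms(1-3) by (simp add: inv_mult_group m_assoc)
  then show ?thesis
    using assms(4,5) E_mult E_inv by simp
qed

lemma transversal_unique:
  assumes "transversal f" "u \<in> U" "v \<in> U" "x \<in> carrier G" "inv (f u) \<otimes> x \<in> E" "inv (f v) \<otimes> x \<in> E"
  shows "u = v"
  using assms same_coset[of "f u" "f v" x] by (simp add: transversal_def)

lemma image_coset:
  assumes "g \<in> carrier G" "S \<subseteq> carrier G"
  shows "x \<in> (\<lambda>t. g \<otimes> t) ` S \<longleftrightarrow> x \<in> carrier G \<and> inv g \<otimes> x \<in> S"
proof
  assume "x \<in> carrier G \<and> inv g \<otimes> x \<in> S"
  then show "x \<in> (\<lambda>t. g \<otimes> t) ` S"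
    using assms by (intro image_eqI[of _ _ "inv g \<otimes> x"]) (simp_all add: m_assoc[symmetric])
qed (use assms in \<open>auto simp: m_assoc[symmetric] subset_iff\<close>)

text \<open>
  The cosets \<open>f u E\<close> are disjoint from each other and from \<open>E\<close>, and together these
  \<open>card U + 1\<close> sets have as many elements as \<open>G\<close>.
\<close>
lemma transversal_cover:
  assumes "transversal f" "x \<in> carrier G" "x \<notin> E"
  obtains u where "u \<in> U" "inv (f u) \<otimes> x \<in> E"
proof -
  let ?C = "\<lambda>u. (\<lambda>t. f u \<otimes> t) ` E"
  have mem: "x \<in> ?C u \<longleftrightarrow> x \<in> carrier G \<and> inv (f u) \<otimes> x \<in> E" if "u \<in> U" for u x
    using image_coset[of "f u" E x] transversal_carrier[OF assms(1) that] E_carrier by blast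
  have card_C: "card (?C u) = card E" if "u \<in> U" for u
    using transversal_carrier[OF assms(1) that] E_carrier
    by (intro card_image) (auto simp: inj_on_def)
  have "card (\<Union>u\<in>U. ?C u) = (\<Sum>u\<in>U. card (?C u))"
  proof (rule card_UN_disjoint)
    show "\<forall>u\<in>U. \<forall>v\<in>U. u \<noteq> v \<longrightarrow> ?C u \<inter> ?C v = {}"
      using mem transversal_unique[OF assms(1)] by blast
  qed (use finite_U finite_E in auto)
  also have "\<dots> = card U * card E"
    using card_C by simp
  finally have "card ((\<Union>u\<in>U. ?C u) \<union> E) = card U * card E + card E"
  proof (subst card_Un_disjoint)
    have False if "u \<in> U" "y \<in> ?C u" "y \<in> E" for u y
    proof -
      have "inv (f u) \<in> E"
        using E_cancel_right[of "inv (f u)" y] mem[OF that(1)] that transversal_carrier[OF assms(1)] by auto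
      then show False
        using E_inv_iff transversal_carrier transversal_not_E assms(1) that(1) by blast
    qed
    then show "(\<Union>u\<in>U. ?C u) \<inter> E = {}"
      by blast
  qed (use finite_U finite_E in auto)
  also have "\<dots> = order G"
    unfolding order_G card_U card_E by (simp add: algebra_simps power_add power_mult power2_eq_square)
  finally have "(\<Union>u\<in>U. ?C u) \<union> E = carrier G"
    using mem E_carrier finite_G by (intro card_subset_eq) (auto simp: order_def)
  then have "x \<in> (\<Union>u\<in>U. ?C u)"
    using assms(2,3) by blast
  then show thesis
    using that mem by blast
qed

lemma mem_coset_union:
  assumes "transversal f"
  shows "x \<in> coset_union f \<longleftrightarrow> x \<in> carrier G \<and> (\<exists>u\<in>U. inv (f u) \<otimes> x \<in> H u)"
proof -
  have "x \<in> (\<lambda>t. f u \<otimes> t) ` H u \<longleftrightarrow> x \<in> carrier G \<and> inv (f u) \<otimes> x \<in> H u" if "u \<in> U" for u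
    using transversal_carrier[OF assms that] E_carrier by (intro image_coset) (auto simp: H_def)
  then show ?thesis
    unfolding coset_union_def by blast
qed

lemma coset_union_carrier: "transversal f \<Longrightarrow> coset_union f \<subseteq> carrier G"
  using mem_coset_union by blast

lemma mem_coset_union_coset:
  assumes "transversal f" "u \<in> U" "x \<in> carrier G" "inv (f u) \<otimes> x \<in> E"
  shows "x \<in> coset_union f \<longleftrightarrow> inv (f u) \<otimes> x \<in> H u"
  using assms mem_coset_union transversal_unique[OF assms(1)] unfolding H_def by blast

lemma coset_union_disjoint_E:
  assumes "transversal f" "x \<in> E"
  shows "x \<notin> coset_union f"
proof
  assume "x \<in> coset_union f"
  then obtain u where u: "u \<in> U" "inv (f u) \<otimes> x \<in> E"
    using mem_coset_union[OF assms(1)] unfolding H_def by blast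
  have "f u \<in> carrier G"
    using transversal_carrier[OF assms(1) u(1)] .
  then have "f u \<in> E"
    using E_cancel_right[of "inv (f u)" x] u(2) assms(2) E_inv_iff by simp
  then show False
    using transversal_not_E[OF assms(1) u(1)] by simp
qed

lemma card_slices:
  assumes "transversal h"
  shows "card {b \<in> coset_union h. P b} = (\<Sum>v\<in>U. card {t \<in> H v. P (h v \<otimes> t)})"
proof -
  have inj: "inj_on (\<lambda>t. h v \<otimes> t) {t \<in> H v. P (h v \<otimes> t)}" if "v \<in> U" for v
    using transversal_carrier[OF assms(1) that] E_carrier by (auto simp: inj_on_def H_def)
  have "{b \<in> coset_union h. P b} = (\<Union>v\<in>U. (\<lambda>t. h v \<otimes> t) ` {t \<in> H v. P (h v \<otimes> t)})"
    unfolding coset_union_def by blast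
  also have "card \<dots> = (\<Sum>v\<in>U. card ((\<lambda>t. h v \<otimes> t) ` {t \<in> H v. P (h v \<otimes> t)}))"
  proof (rule card_UN_disjoint)
    show "\<forall>u\<in>U. finite ((\<lambda>t. h u \<otimes> t) ` {t \<in> H u. P (h u \<otimes> t)})"
      using finite_E by (simp add: H_def)
    have "u = v" if "u \<in> U" "v \<in> U" "h u \<otimes> s = h v \<otimes> t" "s \<in> E" "t \<in> E" for u v s t
    proof -
      have "inv (h u) \<otimes> (h u \<otimes> s) = s" "inv (h v) \<otimes> (h v \<otimes> t) = t"
        using that(1,2,4,5) transversal_carrier[OF assms(1)] E_carrier by (simp_all add: m_assoc[symmetric])
      then show ?thesis
        using transversal_unique[OF assms(1) that(1,2), of "h u \<otimes> s"] that
          transversal_carrier[OF assms(1)] E_carrier by simp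
    qed
    then show "\<forall>u\<in>U. \<forall>v\<in>U. u \<noteq> v \<longrightarrow>
        (\<lambda>t. h u \<otimes> t) ` {t \<in> H u. P (h u \<otimes> t)} \<inter> (\<lambda>t. h v \<otimes> t) ` {t \<in> H v. P (h v \<otimes> t)} = {}"
      unfolding H_def by blast
  qed (rule finite_U)
  also have "\<dots> = (\<Sum>v\<in>U. card {t \<in> H v. P (h v \<otimes> t)})"
    using inj by (intro sum.cong refl card_image)
  finally show ?thesis .
qed

lemma card_coset_union:
  assumes "transversal f"
  shows "card (coset_union f) = 2 ^ d * (2 ^ (d + 1) - 1)"
  using card_slices[OF assms, of "\<lambda>_. True"] card_H card_U by simp

text \<open>
  Quotients are counted slice by slice: a translate \<open>y H\<^sub>v\<close> lies in one coset of \<open>E\<close>, and that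
  coset alone decides how many elements it shares with \<open>coset_union g\<close>.  The trivial coset gives
  none, the coset carrying the same hyperplane gives all or nothing, any other gives a quarter of \<open>E\<close>.
\<close>
lemma slice_in_E:
  assumes "transversal g" "y \<in> E"
  shows "card {t \<in> H v. y \<otimes> t \<in> coset_union g} = 0"
proof -
  have "{t \<in> H v. y \<otimes> t \<in> coset_union g} = {}"
    using coset_union_disjoint_E[OF assms(1)] E_mult[OF assms(2)] by (auto simp: H_def)
  then show ?thesis
    by (simp only: card.empty)
qed

lemma slice_in_coset:
  assumes "transversal g" "u \<in> U" "v \<in> U" "y \<in> carrier G" "inv (g u) \<otimes> y \<in> E"
  shows "card {t \<in> H v. y \<otimes> t \<in> coset_union g} =
    (if u = v then if inv (g u) \<otimes> y \<in> H u then 2 ^ d else 0 else 2 ^ (d - 1))"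
proof -
  have "y \<otimes> t \<in> coset_union g \<longleftrightarrow> (inv (g u) \<otimes> y) \<otimes> t \<in> H u" if "t \<in> H v" for t
  proof -
    have t: "t \<in> E" "t \<in> carrier G" and gu: "g u \<in> carrier G"
      using that E_carrier transversal_carrier[OF assms(1,2)] by (auto simp: H_def)
    then have eq: "inv (g u) \<otimes> (y \<otimes> t) = (inv (g u) \<otimes> y) \<otimes> t"
      using assms(4) by (simp add: m_assoc)
    then have "inv (g u) \<otimes> (y \<otimes> t) \<in> E"
      using E_mult[OF assms(5) t(1)] by simp
    with mem_coset_union_coset[OF assms(1,2), of "y \<otimes> t"] eq assms(4) t(2) show ?thesis
      by simp
  qed
  then have "{t \<in> H v. y \<otimes> t \<in> coset_union g} = {t \<in> H v. (inv (g u) \<otimes> y) \<otimes> t \<in> H u}"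
    by blast
  then show ?thesis
    using card_H_translate_same[OF assms(2,5)] card_H_translate_diff[OF assms(2,3) _ assms(5)]
    by (cases "u = v") simp_all
qed

text \<open>
  The left-hand side is the number of pairs \<open>(a, b)\<close> with \<open>a \<in> D\<close>, \<open>b \<in> coset_union h\<close> and
  \<open>a b\<^sup>-\<^sup>1 = x\<close>.
\<close>
lemma card_quotients:
  assumes "transversal h" "x \<in> carrier G"
  shows "card {b \<in> coset_union h. x \<otimes> b \<in> D} = (\<Sum>v\<in>U. card {t \<in> H v. (x \<otimes> h v) \<otimes> t \<in> D})"
proof -
  have "(\<Sum>v\<in>U. card {t \<in> H v. x \<otimes> (h v \<otimes> t) \<in> D}) = (\<Sum>v\<in>U. card {t \<in> H v. (x \<otimes> h v) \<otimes> t \<in> D})"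
  proof (intro sum.cong refl arg_cong[where f = card] Collect_cong conj_cong)
    fix v t assume "v \<in> U" "t \<in> H v"
    then have "x \<otimes> (h v \<otimes> t) = (x \<otimes> h v) \<otimes> t"
      using assms transversal_carrier[OF assms(1)] E_carrier by (simp add: H_def m_assoc)
    then show "x \<otimes> (h v \<otimes> t) \<in> D \<longleftrightarrow> (x \<otimes> h v) \<otimes> t \<in> D"
      by simp
  qed
  then show ?thesis
    using card_slices[OF assms(1), of "\<lambda>b. x \<otimes> b \<in> D"] by simp
qed

text \<open>
  The one slice of \<open>x coset_union h\<close> that falls into \<open>E\<close> and contributes nothing.
\<close>
lemma unique_inverse_coset:
  assumes "transversal h" "x \<in> carrier G" "x \<notin> E"
  obtains w where "w \<in> U" "x \<otimes> h w \<in> E" "\<And>v. \<lbrakk>v \<in> U; x \<otimes> h v \<in> E\<rbrakk> \<Longrightarrow> v = w"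
proof -
  have eq: "inv (h v) \<otimes> inv x \<in> E \<longleftrightarrow> x \<otimes> h v \<in> E" if "v \<in> U" for v
  proof -
    have hv: "h v \<in> carrier G"
      using transversal_carrier[OF assms(1) that] .
    have "inv (h v) \<otimes> inv x = inv (x \<otimes> h v)"
      using inv_mult_group[OF assms(2) hv] by simp
    then show ?thesis
      using E_inv_iff hv assms(2) by simp
  qed
  have "inv x \<in> carrier G" "inv x \<notin> E"
    using assms E_inv_iff by auto
  then obtain w where "w \<in> U" "inv (h w) \<otimes> inv x \<in> E"
    using transversal_cover[OF assms(1)] by blast
  then show thesis
    using that[of w] eq transversal_unique[OF assms(1) _ _ \<open>inv x \<in> carrier G\<close>] by blast
qed

text \<open>
  For \<open>x \<in> E\<close> every slice stays in its own coset, so it counts fully or not at all according to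
  whether \<open>x\<close> lies in the hyperplane.  For \<open>x \<notin> E\<close> every slice moves to another coset, and all of
  them except the one that falls into \<open>E\<close> contribute a quarter of \<open>E\<close>.
\<close>
lemma card_self_quotients:
  assumes g: "transversal g" and x: "x \<in> carrier G" "x \<noteq> \<one>"
  shows "card {b \<in> coset_union g. x \<otimes> b \<in> coset_union g} = 2 ^ d * (2 ^ d - 1)"
proof (cases "x \<in> E")
  case True
  have "card {t \<in> H v. (x \<otimes> g v) \<otimes> t \<in> coset_union g} = (if \<chi> v x then 0 else 2 ^ d)"
    if "v \<in> U" for v
  proof -
    have gv: "g v \<in> carrier G"
      using transversal_carrier[OF g that] .
    then have "inv (g v) \<otimes> (x \<otimes> g v) = x"
      using x by (simp add: m_comm[of x] m_assoc[symmetric])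
    then show ?thesis
      using slice_in_coset[OF g that that, of "x \<otimes> g v"] True gv x by (simp add: H_def)
  qed
  then have "card {b \<in> coset_union g. x \<otimes> b \<in> coset_union g} = (\<Sum>v\<in>U. if \<chi> v x then 0 else 2 ^ d)"
    unfolding card_quotients[OF g x(1)] by (intro sum.cong) auto
  also have "\<dots> = (\<Sum>v\<in>{u \<in> U. \<not> \<chi> u x}. 2 ^ d)"
    using finite_U by (intro sum.mono_neutral_cong_right) auto
  also have "\<dots> = 2 ^ d * (2 ^ d - 1)"
    using card_kernels[OF True x(2)] by simp
  finally show ?thesis .
next
  case False
  obtain w where w: "w \<in> U" "x \<otimes> g w \<in> E" "\<And>v. \<lbrakk>v \<in> U; x \<otimes> g v \<in> E\<rbrakk> \<Longrightarrow> v = w"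
    using unique_inverse_coset[OF g x(1) False] by blast
  have "card {t \<in> H v. (x \<otimes> g v) \<otimes> t \<in> coset_union g} = 2 ^ (d - 1)" if "v \<in> U - {w}" for v
  proof -
    have v: "v \<in> U" "x \<otimes> g v \<notin> E" and gv: "g v \<in> carrier G"
      using that w(3) transversal_carrier[OF g] by auto
    then obtain u where u: "u \<in> U" "inv (g u) \<otimes> (x \<otimes> g v) \<in> E"
      using transversal_cover[OF g, of "x \<otimes> g v"] x by auto
    have "u \<noteq> v"
    proof
      assume "u = v"
      have "inv (g v) \<otimes> (x \<otimes> g v) = x"
        using x gv by (simp add: m_comm[of x] m_assoc[symmetric])
      then show False
        using u(2) False \<open>u = v\<close> by simp
    qed
    then show ?thesis
      using slice_in_coset[OF g u(1) v(1) _ u(2)] gv x by simp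
  qed
  then have "(\<Sum>v\<in>U - {w}. card {t \<in> H v. (x \<otimes> g v) \<otimes> t \<in> coset_union g}) = card (U - {w}) * 2 ^ (d - 1)"
    by simp
  also have "card (U - {w}) = 2 * (2 ^ d - 1)"
    using card_U finite_U w(1) by (simp add: algebra_simps)
  also have "2 * (2 ^ d - 1) * 2 ^ (d - 1) = 2 ^ d * (2 ^ d - (1::nat))"
    using d_pos by (metis (no_types) Suc_diff_1 One_nat_def Suc_le_eq power_Suc mult.assoc mult.commute)
  finally show ?thesis
    unfolding card_quotients[OF g x(1)] using slice_in_E[OF g w(2)] finite_U w(1)
    by (simp add: sum.remove[of U w])
qed

text \<open>
  The slice of \<open>x coset_union h\<close> with index \<open>v\<close> meets the hyperplane with the same index in
  \<open>coset_union g\<close> exactly when \<open>x\<close> lies in the coset of \<open>g\<^sub>v h\<^sub>v\<^sup>-\<^sup>1\<close>.  As the quotient is again a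
  transversal, this happens for exactly one \<open>v\<close> if \<open>x \<notin> E\<close>, and for none if \<open>x \<in> E\<close>.
\<close>
lemma card_cross_quotients:
  assumes g: "transversal g" and h: "transversal h"
    and gh: "transversal (\<lambda>u. g u \<otimes> inv (h u))" and x: "x \<in> carrier G"
  shows "card {b \<in> coset_union h. x \<otimes> b \<in> coset_union g} =
    (if x \<in> E then 2 ^ (d - 1) * (2 ^ (d + 1) - 1)
     else (if x \<in> coset_union (\<lambda>u. g u \<otimes> inv (h u)) then 2 ^ d else 0) + 2 ^ (d - 1) * (2 ^ (d + 1) - 3))"
proof -
  let ?f = "\<lambda>u. g u \<otimes> inv (h u)"
  let ?c = "\<lambda>v. card {t \<in> H v. (x \<otimes> h v) \<otimes> t \<in> coset_union g}"
  have car: "g u \<in> carrier G" "h u \<in> carrier G" if "u \<in> U" for u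
    using transversal_carrier[OF g that] transversal_carrier[OF h that] .
  have eq: "inv (?f v) \<otimes> x = inv (g v) \<otimes> (x \<otimes> h v)" if "v \<in> U" for v
    using car[OF that] x by (simp add: inv_mult_group m_ac)
  have generic: "?c v = 2 ^ (d - 1)" if v: "v \<in> U" "x \<otimes> h v \<notin> E" "inv (?f v) \<otimes> x \<notin> E" for v
  proof -
    obtain u where u: "u \<in> U" "inv (g u) \<otimes> (x \<otimes> h v) \<in> E"
      using transversal_cover[OF g, of "x \<otimes> h v"] v x car by auto
    then have "u \<noteq> v"
      using eq[OF v(1)] v(3) by auto
    then show ?thesis
      using slice_in_coset[OF g u(1) v(1) _ u(2)] car[OF v(1)] x by simp
  qed
  show ?thesis
  proof (cases "x \<in> E")
    case True
    have "?c v = 2 ^ (d - 1)" if v: "v \<in> U" for v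
    proof (rule generic[OF v])
      show "x \<otimes> h v \<notin> E"
        using E_cancel_left[OF car(2)[OF v] True] transversal_not_E[OF h v] by simp
      have f: "?f v \<in> carrier G" "?f v \<notin> E"
        using transversal_carrier[OF gh v] transversal_not_E[OF gh v] .
      then show "inv (?f v) \<otimes> x \<notin> E"
        using E_cancel_right[OF _ True, of "inv (?f v)"] E_inv_iff[of "?f v"] by simp
    qed
    then show ?thesis
      unfolding card_quotients[OF h x] using True card_U by simp
  next
    case False
    obtain w where w: "w \<in> U" "x \<otimes> h w \<in> E" "\<And>v. \<lbrakk>v \<in> U; x \<otimes> h v \<in> E\<rbrakk> \<Longrightarrow> v = w"
      using unique_inverse_coset[OF h x False] by blast
    obtain u where u: "u \<in> U" "inv (?f u) \<otimes> x \<in> E"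
      using transversal_cover[OF gh x False] by blast
    have "u \<noteq> w"
    proof
      assume "u = w"
      then have "inv (g w) \<in> E"
        using u(2) w(1,2) E_cancel_right[OF _ w(2), of "inv (g w)"] car[OF w(1)] eq[OF w(1)] by simp
      then show False
        using E_inv_iff car[OF w(1)] transversal_not_E[OF g w(1)] by simp
    qed
    have "?c w = 0"
      using slice_in_E[OF g w(2)] .
    moreover have "?c u = (if x \<in> coset_union ?f then 2 ^ d else 0)"
      using slice_in_coset[OF g u(1) u(1), of "x \<otimes> h u"] u eq[OF u(1)] car[OF u(1)] x
        mem_coset_union_coset[OF gh u(1) x u(2)] by simp
    moreover have "(\<Sum>v\<in>U - {w} - {u}. ?c v) = card (U - {w} - {u}) * 2 ^ (d - 1)"
    proof -
      have "?c v = 2 ^ (d - 1)" if "v \<in> U - {w} - {u}" for v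
        using that w(3) transversal_unique[OF gh u(1) _ x u(2)] by (intro generic) blast+
      then show ?thesis
        by simp
    qed
    moreover have "card (U - {w} - {u}) = 2 ^ (d + 1) - 3"
      using finite_U w(1) u(1) \<open>u \<noteq> w\<close> card_U by simp
    moreover have "(\<Sum>v\<in>U. ?c v) = ?c w + (?c u + (\<Sum>v\<in>U - {w} - {u}. ?c v))"
      using finite_U w(1) u(1) \<open>u \<noteq> w\<close> by (simp add: sum.remove[of U w] sum.remove[of "U - {w}" u])
    ultimately show ?thesis
      unfolding card_quotients[OF h x] using False by simp
  qed
qed

text \<open>
  Multiplying \<open>f u\<close> by an element outside the hyperplane replaces the translated hyperplane by its
  complement in the coset.
\<close>
lemma complement_transversal:
  assumes f: "transversal f"
  obtains f' where "transversal f'"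
    "\<And>x. x \<in> carrier G \<Longrightarrow> x \<in> coset_union f' \<longleftrightarrow> x \<notin> E \<and> x \<notin> coset_union f"
proof -
  obtain t where t: "\<And>u. u \<in> U \<Longrightarrow> t u \<in> E \<and> \<chi> u (t u)"
    using char_nontrivial by metis
  define f' where "f' = (\<lambda>u. f u \<otimes> t u)"
  have car: "f u \<in> carrier G" "t u \<in> carrier G" if "u \<in> U" for u
    using transversal_carrier[OF f that] t[OF that] E_carrier by auto
  have eq: "inv (f' u) \<otimes> x = inv (t u) \<otimes> (inv (f u) \<otimes> x)" if "u \<in> U" "x \<in> carrier G" for u x
    using car[OF that(1)] that(2) by (simp add: f'_def inv_mult_group m_assoc)
  have coset: "inv (f' u) \<otimes> x \<in> E \<longleftrightarrow> inv (f u) \<otimes> x \<in> E" if "u \<in> U" "x \<in> carrier G" for u x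
    unfolding eq[OF that] using that car[OF that(1)] t[OF that(1)] E_inv by (intro E_cancel_left) auto
  have char: "\<chi> u (inv (f' u) \<otimes> x) \<longleftrightarrow> \<not> \<chi> u (inv (f u) \<otimes> x)"
    if "u \<in> U" "x \<in> carrier G" "inv (f u) \<otimes> x \<in> E" for u x
    unfolding eq[OF that(1,2)] using char_mult[OF that(1) _ that(3)] t[OF that(1)] E_inv char_inv that(1)
    by auto
  have f': "transversal f'"
    unfolding transversal_def
  proof (intro conjI ballI impI)
    fix u assume u: "u \<in> U"
    show "f' u \<in> carrier G"
      using car[OF u] by (simp add: f'_def)
    show "f' u \<notin> E"
      using E_cancel_right[of "f u" "t u"] car[OF u] t[OF u] transversal_not_E[OF f u] by (simp add: f'_def)
    fix v assume v: "v \<in> U" and "inv (f' u) \<otimes> f' v \<in> E"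
    then have "inv (f u) \<otimes> (f v \<otimes> t v) \<in> E"
      using coset[OF u, of "f' v"] car[OF v] by (simp add: f'_def)
    then have "inv (f u) \<otimes> f v \<in> E"
      using E_cancel_right[of "inv (f u) \<otimes> f v" "t v"] car[OF u] car[OF v] t[OF v] by (simp add: m_assoc)
    then show "u = v"
      using f u v by (simp add: transversal_def)
  qed
  have "x \<in> coset_union f' \<longleftrightarrow> x \<notin> E \<and> x \<notin> coset_union f" if x: "x \<in> carrier G" for x
  proof (cases "x \<in> E")
    case True
    then show ?thesis
      using coset_union_disjoint_E[OF f'] by simp
  next
    case False
    then obtain u where u: "u \<in> U" "inv (f u) \<otimes> x \<in> E"
      using transversal_cover[OF f x] by blast
    then show ?thesis
      using mem_coset_union_coset[OF f u(1) x u(2)] mem_coset_union_coset[OF f' u(1) x]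
        coset[OF u(1) x] char[OF u(1) x] False by (simp add: H_def)
  qed
  with f' show thesis
    using that by blast
qed

lemma difference_set_coset_union:
  assumes f: "transversal f"
  shows "difference_set G (2 ^ (2 * d + 2)) (2 ^ d * (2 ^ (d + 1) - 1)) (2 ^ d * (2 ^ d - 1)) (2 ^ (2 * d))
           (coset_union f)"
  unfolding difference_set_def
proof (intro conjI ballI)
  let ?D = "coset_union f"
  fix x assume x: "x \<in> carrier G - {\<one>}"
  let ?P = "{(a, b). a \<in> ?D \<and> b \<in> ?D \<and> a \<noteq> b}"
  have fin: "finite ?D"
    using finite_G coset_union_carrier[OF f] finite_subset by blast
  then have "finite ?P"
    by (auto intro: finite_subset[of _ "?D \<times> ?D"])
  then have "count {#a \<otimes> inv b. (a, b) \<in># mset_set ?P#} x = card {p \<in> ?P. (case p of (a, b) \<Rightarrow> a \<otimes> inv b) = x}"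
    by (simp add: count_image_mset vimage_def Int_def conj_commute)
  also have "\<dots> = card {b \<in> ?D. x \<otimes> b \<in> ?D}"
  proof (rule bij_betw_same_card)
    have car: "a \<in> carrier G" if "a \<in> ?D" for a
      using that coset_union_carrier[OF f] by blast
    show "bij_betw snd {p \<in> ?P. (case p of (a, b) \<Rightarrow> a \<otimes> inv b) = x} {b \<in> ?D. x \<otimes> b \<in> ?D}"
    proof (rule bij_betw_byWitness[where f' = "\<lambda>b. (x \<otimes> b, b)"])
      show "snd ` {p \<in> ?P. (case p of (a, b) \<Rightarrow> a \<otimes> inv b) = x} \<subseteq> {b \<in> ?D. x \<otimes> b \<in> ?D}"
        using car by (auto simp: m_assoc)
      show "(\<lambda>b. (x \<otimes> b, b)) ` {b \<in> ?D. x \<otimes> b \<in> ?D} \<subseteq> {p \<in> ?P. (case p of (a, b) \<Rightarrow> a \<otimes> inv b) = x}"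
        using car x by (auto simp: m_assoc)
    qed (use car in \<open>auto simp: m_assoc\<close>)
  qed
  also have "\<dots> = 2 ^ d * (2 ^ d - 1)"
    using card_self_quotients[OF f] x by simp
  finally show "count {#a \<otimes> inv b. (a, b) \<in># mset_set ?P#} x = 2 ^ d * (2 ^ d - 1)" .
next
  show "(2::int) ^ (2 * d) = int (2 ^ d * (2 ^ (d + 1) - 1)) - int (2 ^ d * (2 ^ d - 1))"
  proof -
    have "int (2 ^ (d + 1) - 1) = 2 * 2 ^ d - 1" "int (2 ^ d - 1) = 2 ^ d - 1"
      by (simp_all add: of_nat_diff)
    moreover have "(2::int) ^ (2 * d) = 2 ^ d * 2 ^ d"
      unfolding mult_2 power_add by (rule refl)
    ultimately show ?thesis
      unfolding of_nat_mult by (simp add: algebra_simps)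
  qed
qed (use is_group finite_G order_G coset_union_carrier[OF f] card_coset_union[OF f] in auto)

lemma lookup_sum_frag_of:
  "finite S \<Longrightarrow> Poly_Mapping.lookup (\<Sum>s\<in>S. frag_of s) x = (if x \<in> S then 1 else 0)"
  by (simp add: lookup_sum)

lemma keys_sum_frag_of: "finite S \<Longrightarrow> Poly_Mapping.keys (\<Sum>s\<in>S. frag_of s) = S"
  unfolding set_eq_iff in_keys_iff by (simp only: lookup_sum_frag_of) simp

lemma lookup_group_ring_mult:
  assumes "A \<subseteq> carrier G" "B \<subseteq> carrier G"
  shows "Poly_Mapping.lookup (group_ring_mult G (\<Sum>a\<in>A. frag_of a) (\<Sum>b\<in>B. frag_of (inv b))) x =
    (if x \<in> carrier G then int (card {b \<in> B. x \<otimes> b \<in> A}) else 0)"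
proof -
  have fin: "finite A" "finite B"
    using assms finite_G finite_subset by blast+
  have inj: "inj_on (\<lambda>b. inv b) B"
    using assms(2) by (intro inj_on_inverseI[where g = "\<lambda>b. inv b"]) auto
  have "(\<Sum>b\<in>B. frag_of (inv b)) = (\<Sum>b\<in>(\<lambda>b. inv b) ` B. frag_of b)"
    using inj by (simp add: sum.reindex)
  then have "group_ring_mult G (\<Sum>a\<in>A. frag_of a) (\<Sum>b\<in>B. frag_of (inv b)) =
      (\<Sum>a\<in>A. \<Sum>b\<in>(\<lambda>b. inv b) ` B. frag_of (a \<otimes> b))"
    using fin by (simp add: group_ring_mult_def keys_sum_frag_of lookup_sum_frag_of)
  also have "\<dots> = (\<Sum>b\<in>B. \<Sum>a\<in>A. frag_of (a \<otimes> inv b))"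
    using inj by (subst sum.swap) (simp add: sum.reindex)
  finally have "Poly_Mapping.lookup (group_ring_mult G (\<Sum>a\<in>A. frag_of a) (\<Sum>b\<in>B. frag_of (inv b))) x =
      (\<Sum>b\<in>B. \<Sum>a\<in>A. if x = a \<otimes> inv b then 1 else 0)"
    by (simp add: lookup_sum)
  also have "\<dots> = (\<Sum>b\<in>B. if x \<in> carrier G \<and> x \<otimes> b \<in> A then 1 else 0)"
  proof (intro sum.cong refl)
    fix b assume b: "b \<in> B"
    have "x = a \<otimes> inv b \<longleftrightarrow> x \<in> carrier G \<and> a = x \<otimes> b" if "a \<in> A" for a
    proof -
      have "a \<in> carrier G" "b \<in> carrier G"
        using that b assms by auto
      then show ?thesis
        by (auto simp: m_assoc)
    qed
    then have "(\<Sum>a\<in>A. if x = a \<otimes> inv b then 1 else 0) =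
        (\<Sum>a\<in>A. if x \<in> carrier G \<and> a = x \<otimes> b then 1 else (0::int))"
      by (intro sum.cong) auto
    also have "\<dots> = (if x \<in> carrier G \<and> x \<otimes> b \<in> A then 1 else 0)"
      using fin by (cases "x \<in> carrier G") auto
    finally show "(\<Sum>a\<in>A. if x = a \<otimes> inv b then 1 else 0) =
        (if x \<in> carrier G \<and> x \<otimes> b \<in> A then 1 else (0::int))" .
  qed
  also have "\<dots> = (if x \<in> carrier G then int (card {b \<in> B. x \<otimes> b \<in> A}) else 0)"
    using fin by (simp add: sum.If_cases Int_def)
  finally show ?thesis .
qed

text \<open>
  The counts of quotients are the coefficients of the product.  They are smaller by \<open>2\<^sup>d\<close> on the
  complement of the hyperplane translates in \<open>G - E\<close> than everywhere else, and that complement is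
  itself a McFarland--Dillon difference set.
\<close>
lemma linking_identity:
  assumes g: "transversal g" and h: "transversal h" and gh: "transversal (\<lambda>u. g u \<otimes> inv (h u))"
  obtains f where "transversal f"
    "group_ring_mult G (\<Sum>a\<in>coset_union g. frag_of a) (\<Sum>b\<in>coset_union h. frag_of (inv b)) =
       frag_cmul (- (2 ^ d)) (\<Sum>a\<in>coset_union f. frag_of a) +
       frag_cmul (2 ^ (d - 1) * (2 ^ (d + 1) - 1)) (\<Sum>a\<in>carrier G. frag_of a)"
proof -
  obtain f where f: "transversal f"
    "\<And>x. x \<in> carrier G \<Longrightarrow> x \<in> coset_union f \<longleftrightarrow> x \<notin> E \<and> x \<notin> coset_union (\<lambda>u. g u \<otimes> inv (h u))"
    using complement_transversal[OF gh] by blast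
  have fin: "finite (coset_union f)"
    using coset_union_carrier[OF f(1)] finite_G finite_subset by blast
  obtain m where m: "d = Suc m"
    using d_pos by (cases d) auto
  have "(1::nat) \<le> 2 ^ m"
    by simp
  then have "(3::nat) \<le> 4 * 2 ^ m"
    by linarith
  then have diff: "int (4 * 2 ^ m - 3) = 4 * 2 ^ m - 3"
    by (simp add: of_nat_diff)
  have count: "int (card {b \<in> coset_union h. x \<otimes> b \<in> coset_union g}) =
      - (2 ^ d) * (if x \<in> coset_union f then 1 else 0) + 2 ^ (d - 1) * (2 ^ (d + 1) - 1)"
    if x: "x \<in> carrier G" for x
    unfolding card_cross_quotients[OF g h gh x] f(2)[OF x] using coset_union_disjoint_E[OF gh, of x]
    by (auto simp del: power_Suc) (simp_all add: m diff algebra_simps)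
  show thesis
  proof (rule that[OF f(1)], rule poly_mapping_eqI)
    fix x
    show "Poly_Mapping.lookup (group_ring_mult G (\<Sum>a\<in>coset_union g. frag_of a)
            (\<Sum>b\<in>coset_union h. frag_of (inv b))) x =
          Poly_Mapping.lookup (frag_cmul (- (2 ^ d)) (\<Sum>a\<in>coset_union f. frag_of a) +
            frag_cmul (2 ^ (d - 1) * (2 ^ (d + 1) - 1)) (\<Sum>a\<in>carrier G. frag_of a)) x"
      using count[of x] coset_union_carrier[OF f(1)] fin finite_G
        lookup_group_ring_mult[OF coset_union_carrier[OF g] coset_union_carrier[OF h], of x]
      by (auto simp: lookup_add lookup_sum_frag_of)
  qed
qed

text \<open>
  If the two sets were equal, the identity would be a quotient in \<open>card (coset_union h)\<close> ways, which
  is twice the number given by the cross count.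
\<close>
lemma coset_union_distinct:
  assumes g: "transversal g" and h: "transversal h" and gh: "transversal (\<lambda>u. g u \<otimes> inv (h u))"
  shows "coset_union g \<noteq> coset_union h"
proof
  assume eq: "coset_union g = coset_union h"
  have "{b \<in> coset_union h. \<one> \<otimes> b \<in> coset_union g} = coset_union h"
    using eq coset_union_carrier[OF h] by auto
  then have "2 ^ d * (2 ^ (d + 1) - 1) = 2 ^ (d - 1) * (2 ^ (d + 1) - (1::nat))"
    using card_cross_quotients[OF g h gh one_closed] card_coset_union[OF h] E_one by simp
  moreover have "(2::nat) ^ (d - 1) < 2 ^ d" "0 < 2 ^ (d + 1) - (1::nat)"
    using d_pos one_less_power[of "2::nat" "d + 1"] by simp_all
  ultimately show False
    by (metis mult_cancel2 less_irrefl)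
qed

theorem reduced_linking_system_coset_unions:
  assumes T: "finite T" "2 \<le> card T"
    and tr: "\<And>s. s \<in> T \<Longrightarrow> transversal (f s)"
    and quot: "\<And>s t. \<lbrakk>s \<in> T; t \<in> T; s \<noteq> t\<rbrakk> \<Longrightarrow> transversal (\<lambda>u. f s u \<otimes> inv (f t u))"
  shows "reduced_linking_system G (2 ^ (2 * d + 2)) (2 ^ d * (2 ^ (d + 1) - 1)) (2 ^ d * (2 ^ d - 1))
           (2 ^ (2 * d)) (card T) ((\<lambda>s. coset_union (f s)) ` T)"
proof -
  have inj: "inj_on (\<lambda>s. coset_union (f s)) T"
    using coset_union_distinct tr quot unfolding inj_on_def by blast
  define \<nu> :: int where "\<nu> = 2 ^ (d - 1) * (2 ^ (d + 1) - 1)"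
  define \<mu> :: int where "\<mu> = \<nu> - 2 ^ d"
  have link: "\<exists>D. difference_set G (2 ^ (2 * d + 2)) (2 ^ d * (2 ^ (d + 1) - 1)) (2 ^ d * (2 ^ d - 1))
        (2 ^ (2 * d)) D \<and>
      group_ring_mult G (\<Sum>a\<in>coset_union (f s). frag_of a) (\<Sum>b\<in>coset_union (f t). frag_of (inv b)) =
        frag_cmul (\<mu> - \<nu>) (\<Sum>a\<in>D. frag_of a) + frag_cmul \<nu> (\<Sum>a\<in>carrier G. frag_of a)"
    if st: "s \<in> T" "t \<in> T" "s \<noteq> t" for s t
  proof -
    have \<mu>\<nu>: "\<mu> - \<nu> = - (2 ^ d)"
      by (simp add: \<mu>_def)
    obtain h where h: "transversal h"
      "group_ring_mult G (\<Sum>a\<in>coset_union (f s). frag_of a) (\<Sum>b\<in>coset_union (f t). frag_of (inv b)) =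
        frag_cmul (\<mu> - \<nu>) (\<Sum>a\<in>coset_union h. frag_of a) + frag_cmul \<nu> (\<Sum>a\<in>carrier G. frag_of a)"
      using linking_identity[OF tr[OF st(1)] tr[OF st(2)] quot[OF st]]
      unfolding \<mu>\<nu> unfolding \<nu>_def by blast
    then show ?thesis
      using difference_set_coset_union by blast
  qed
  have "\<forall>D\<in>(\<lambda>s. coset_union (f s)) ` T. \<forall>D'\<in>(\<lambda>s. coset_union (f s)) ` T. D \<noteq> D' \<longrightarrow>
      (\<exists>D''. difference_set G (2 ^ (2 * d + 2)) (2 ^ d * (2 ^ (d + 1) - 1)) (2 ^ d * (2 ^ d - 1))
        (2 ^ (2 * d)) D'' \<and>
      group_ring_mult G (\<Sum>a\<in>D. frag_of a) (\<Sum>b\<in>D'. frag_of (inv b)) =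
        frag_cmul (\<mu> - \<nu>) (\<Sum>a\<in>D''. frag_of a) + frag_cmul \<nu> (\<Sum>a\<in>carrier G. frag_of a))"
    (is "?linked")
  proof (intro ballI impI)
    fix D D' assume "D \<in> (\<lambda>s. coset_union (f s)) ` T" "D' \<in> (\<lambda>s. coset_union (f s)) ` T" "D \<noteq> D'"
    then obtain s t where st: "s \<in> T" "t \<in> T" "s \<noteq> t" "D = coset_union (f s)" "D' = coset_union (f t)"
      by blast
    then show "\<exists>D''. difference_set G (2 ^ (2 * d + 2)) (2 ^ d * (2 ^ (d + 1) - 1)) (2 ^ d * (2 ^ d - 1))
        (2 ^ (2 * d)) D'' \<and>
      group_ring_mult G (\<Sum>a\<in>D. frag_of a) (\<Sum>b\<in>D'. frag_of (inv b)) =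
        frag_cmul (\<mu> - \<nu>) (\<Sum>a\<in>D''. frag_of a) + frag_cmul \<nu> (\<Sum>a\<in>carrier G. frag_of a)"
      using link[OF st(1-3)] by simp
  qed
  then show ?thesis
    unfolding reduced_linking_system_def
    using is_group finite_G order_G T card_image[OF inj] difference_set_coset_union[OF tr] by blast
qed

end

section \<open>Products of cyclic 2-groups\<close>

text \<open>
  The group \<open>\<Gamma> = \<Prod>\<^sub>k \<int>/2\<^bsup>b k + 1\<^esup>\<close> has \<open>n\<close> nontrivial factors.  Its elements of order at most
  two form an elementary abelian subgroup, the socle, of order \<open>2\<^sup>n\<close>, and the quotient by the socle is
  \<open>\<Prod>\<^sub>k \<int>/2\<^bsup>b k\<^esup>\<close>, the group over which the contracted difference matrix is taken.
\<close>
locale residue_vectors =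
  fixes n :: nat and b :: "nat \<Rightarrow> nat"
begin

definition \<Gamma> :: "(nat \<Rightarrow> int) monoid" where
  "\<Gamma> = product_group {..<n} (\<lambda>k. integer_mod_group (2 ^ (b k + 1)))"

text \<open>
  Computing with arbitrary integer representatives avoids reductions inside sums.
\<close>
definition vec :: "(nat \<Rightarrow> int) \<Rightarrow> nat \<Rightarrow> int" where
  "vec z = (\<lambda>k\<in>{..<n}. z k mod 2 ^ (b k + 1))"

lemma carrier_\<Gamma>: "carrier \<Gamma> = (\<Pi>\<^sub>E k\<in>{..<n}. {0..<2 ^ (b k + 1)})"
  by (simp add: \<Gamma>_def carrier_integer_mod_group)

lemma vec_apply: "k < n \<Longrightarrow> vec z k = z k mod 2 ^ (b k + 1)"
  by (simp add: vec_def)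

lemma vec_carrier [simp]: "vec z \<in> carrier \<Gamma>"
  by (auto simp: carrier_\<Gamma> vec_def)

lemma vec_self: "x \<in> carrier \<Gamma> \<Longrightarrow> vec x = x"
  by (rule ext) (auto simp: carrier_\<Gamma> vec_def PiE_iff extensional_def restrict_def)

lemma vec_eq_iff: "vec z = vec w \<longleftrightarrow> (\<forall>k<n. z k mod 2 ^ (b k + 1) = w k mod 2 ^ (b k + 1))"
  by (auto simp: vec_def restrict_def fun_eq_iff)

lemma vec_mult: "vec z \<otimes>\<^bsub>\<Gamma>\<^esub> vec w = vec (\<lambda>k. z k + w k)"
  by (auto simp: \<Gamma>_def vec_def mod_add_eq restrict_def fun_eq_iff)

lemma one_\<Gamma>: "\<one>\<^bsub>\<Gamma>\<^esub> = vec (\<lambda>k. 0)"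
  by (auto simp: \<Gamma>_def vec_def restrict_def fun_eq_iff)

lemma comm_group_\<Gamma>: "comm_group \<Gamma>"
proof (rule group.group_comm_groupI)
  show "group \<Gamma>"
    unfolding \<Gamma>_def by (rule product_group) simp
  show "x \<otimes>\<^bsub>\<Gamma>\<^esub> y = y \<otimes>\<^bsub>\<Gamma>\<^esub> x" if "x \<in> carrier \<Gamma>" "y \<in> carrier \<Gamma>" for x y
    using vec_mult[of x y] vec_mult[of y x] that by (simp add: vec_self add.commute)
qed

sublocale \<Gamma>: comm_group \<Gamma>
  by (rule comm_group_\<Gamma>)

lemma vec_inv: "inv\<^bsub>\<Gamma>\<^esub> vec z = vec (\<lambda>k. - z k)"
  by (rule \<Gamma>.inv_equality) (simp_all add: vec_mult one_\<Gamma>)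

lemma vec_pow: "vec z [^]\<^bsub>\<Gamma>\<^esub> (m::nat) = vec (\<lambda>k. int m * z k)"
  by (induction m) (simp_all add: one_\<Gamma> vec_mult algebra_simps)

lemma order_\<Gamma>: "order \<Gamma> = 2 ^ (n + (\<Sum>k<n. b k))"
proof -
  have "order \<Gamma> = (\<Prod>k<n. 2 ^ (b k + 1))"
    unfolding order_def carrier_\<Gamma> by (subst card_PiE) (simp_all add: nat_mult_distrib nat_power_eq)
  also have "\<dots> = 2 ^ (\<Sum>k<n. b k + 1)"
    by (rule power_sum[symmetric])
  also have "(\<Sum>k<n. b k + 1) = n + (\<Sum>k<n. b k)"
    unfolding sum.distrib by simp
  finally show ?thesis .
qed

lemma finite_\<Gamma>: "finite (carrier \<Gamma>)"
  by (simp add: carrier_\<Gamma> finite_PiE)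

lemma group_exponent_\<Gamma>:
  assumes "j < n" "\<And>k. k < n \<Longrightarrow> b k \<le> b j"
  shows "group_exponent \<Gamma> = 2 ^ (b j + 1)"
  unfolding group_exponent_def
proof (rule Least_equality)
  have "x [^]\<^bsub>\<Gamma>\<^esub> ((2::nat) ^ (b j + 1)) = \<one>\<^bsub>\<Gamma>\<^esub>" if x: "x \<in> carrier \<Gamma>" for x
  proof -
    have "(2::int) ^ (b j + 1) * x k mod 2 ^ (b k + 1) = 0" if "k < n" for k
    proof -
      have "(2::int) ^ (b k + 1) dvd 2 ^ (b j + 1)"
        using assms(2)[OF that] by (intro le_imp_power_dvd) simp
      then show ?thesis
        by (simp add: mod_eq_0_iff_dvd del: power_Suc)
    qed
    then show ?thesis
      using vec_pow[of x "2 ^ (b j + 1)"] vec_self[OF x] by (simp add: one_\<Gamma> vec_eq_iff)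
  qed
  then show "0 < (2::nat) ^ (b j + 1) \<and> (\<forall>x\<in>carrier \<Gamma>. x [^]\<^bsub>\<Gamma>\<^esub> ((2::nat) ^ (b j + 1)) = \<one>\<^bsub>\<Gamma>\<^esub>)"
    by simp
next
  fix m :: nat
  assume m: "0 < m \<and> (\<forall>x\<in>carrier \<Gamma>. x [^]\<^bsub>\<Gamma>\<^esub> m = \<one>\<^bsub>\<Gamma>\<^esub>)"
  then have "vec (\<lambda>k. 1) [^]\<^bsub>\<Gamma>\<^esub> m = \<one>\<^bsub>\<Gamma>\<^esub>"
    by simp
  then have "int m mod 2 ^ (b j + 1) = 0"
    using assms(1) by (auto simp: vec_pow one_\<Gamma> vec_eq_iff)
  then have "int (2 ^ (b j + 1)) dvd int m"
    by (simp add: mod_eq_0_iff_dvd)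
  then have "2 ^ (b j + 1) dvd m"
    by (simp only: of_nat_dvd_iff)
  then show "2 ^ (b j + 1) \<le> m"
    using m by (simp add: dvd_imp_le)
qed

lemma even_mod_power: "even ((z::int) mod (2 * 2 ^ m)) \<longleftrightarrow> even z"
  by (simp add: dvd_mod_iff)

text \<open>
  Modulo squares a generated element depends only on which generators occur an odd number of times in
  it.  Since \<open>\<Gamma>\<close> has \<open>2\<^sup>n\<close> classes modulo squares, at least \<open>n\<close> generators are needed.
\<close>
lemma generate_parities:
  assumes "finite S" "S \<subseteq> carrier \<Gamma>" "x \<in> generate \<Gamma> S"
  shows "\<exists>T\<subseteq>S. \<forall>k<n. even (x k) \<longleftrightarrow> even (\<Sum>s\<in>T. s k)"
  using assms(3)
proof (induction rule: generate.induct)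
  case one
  show ?case
    by (intro exI[of _ "{}"]) (simp add: one_\<Gamma> vec_apply)
next
  case (incl h)
  then show ?case
    by (intro exI[of _ "{h}"]) simp
next
  case (inv h)
  have "inv\<^bsub>\<Gamma>\<^esub> h = vec (\<lambda>k. - h k)"
    using vec_inv[of h] vec_self[of h] inv assms(2) by auto
  then show ?case
    using inv by (intro exI[of _ "{h}"]) (simp add: vec_apply even_mod_power)
next
  case (eng h1 h2)
  then obtain T1 T2 where T: "T1 \<subseteq> S" "T2 \<subseteq> S"
    "\<forall>k<n. even (h1 k) \<longleftrightarrow> even (\<Sum>s\<in>T1. s k)" "\<forall>k<n. even (h2 k) \<longleftrightarrow> even (\<Sum>s\<in>T2. s k)"
    by blast
  have fin: "finite T1" "finite T2"
    using T(1,2) assms(1) finite_subset by auto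
  have "h1 \<in> carrier \<Gamma>" "h2 \<in> carrier \<Gamma>"
    using eng.hyps \<Gamma>.generate_in_carrier[OF assms(2)] by auto
  then have "h1 \<otimes>\<^bsub>\<Gamma>\<^esub> h2 = vec (\<lambda>k. h1 k + h2 k)"
    using vec_mult[of h1 h2] by (simp add: vec_self)
  moreover have "(\<Sum>s\<in>T1. s k) + (\<Sum>s\<in>T2. s k) = (\<Sum>s\<in>(T1 - T2) \<union> (T2 - T1). s k) + 2 * (\<Sum>s\<in>T1 \<inter> T2. s k)"
    for k
  proof -
    have "(\<Sum>s\<in>T1. s k) = (\<Sum>s\<in>T1 - T2. s k) + (\<Sum>s\<in>T1 \<inter> T2. s k)"
      using fin by (metis add.commute sum.Int_Diff)
    moreover have "(\<Sum>s\<in>T2. s k) = (\<Sum>s\<in>T2 - T1. s k) + (\<Sum>s\<in>T1 \<inter> T2. s k)"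
      using fin by (metis add.commute inf_commute sum.Int_Diff)
    moreover have "(\<Sum>s\<in>(T1 - T2) \<union> (T2 - T1). s k) = (\<Sum>s\<in>T1 - T2. s k) + (\<Sum>s\<in>T2 - T1. s k)"
      using fin by (intro sum.union_disjoint) auto
    ultimately show ?thesis
      by simp
  qed
  then have "even ((\<Sum>s\<in>T1. s k) + (\<Sum>s\<in>T2. s k)) \<longleftrightarrow> even (\<Sum>s\<in>(T1 - T2) \<union> (T2 - T1). s k)" for k
    by simp
  ultimately show ?case
    using T by (intro exI[of _ "(T1 - T2) \<union> (T2 - T1)"])
      (auto simp: vec_apply even_mod_power)
qed

lemma card_generators_ge:
  assumes "finite S" "S \<subseteq> carrier \<Gamma>" "generate \<Gamma> S = carrier \<Gamma>"
  shows "n \<le> card S"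
proof -
  have "Pow {..<n} \<subseteq> (\<lambda>T. {k. k < n \<and> odd (\<Sum>s\<in>T. s k)}) ` Pow S"
  proof
    fix Q assume "Q \<in> Pow {..<n}"
    then have "Q \<subseteq> {..<n}"
      by blast
    let ?x = "vec (\<lambda>k. if k \<in> Q then 1 else 0)"
    obtain T where T: "T \<subseteq> S" "\<forall>k<n. even (?x k) \<longleftrightarrow> even (\<Sum>s\<in>T. s k)"
      using generate_parities[OF assms(1,2), of ?x] assms(3) by auto
    have "even (?x k) \<longleftrightarrow> k \<notin> Q" if "k < n" for k
      using that by (simp add: vec_apply even_mod_power)
    then have "Q = {k. k < n \<and> odd (\<Sum>s\<in>T. s k)}"
      using T(2) \<open>Q \<subseteq> {..<n}\<close> by auto
    with T(1) show "Q \<in> (\<lambda>T. {k. k < n \<and> odd (\<Sum>s\<in>T. s k)}) ` Pow S"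
      by blast
  qed
  then have "card (Pow {..<n}) \<le> card (Pow S)"
    using assms(1) by (meson card_image_le card_mono finite_Pow_iff finite_imageI order_trans)
  then show ?thesis
    using assms(1) by (simp add: card_Pow)
qed

definition unit_vec :: "nat \<Rightarrow> nat \<Rightarrow> int" where
  "unit_vec j = vec (\<lambda>k. if k = j then 1 else 0)"

lemma generate_units: "generate \<Gamma> (unit_vec ` {..<n}) = carrier \<Gamma>"
proof
  show "generate \<Gamma> (unit_vec ` {..<n}) \<subseteq> carrier \<Gamma>"
    by (rule \<Gamma>.generate_incl) (auto simp: unit_vec_def)
next
  have "m \<le> n \<Longrightarrow> vec (\<lambda>k. if k < m then int (p k) else 0) \<in> generate \<Gamma> (unit_vec ` {..<n})" for m and p :: "nat \<Rightarrow> nat"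
  proof (induction m)
    case 0
    show ?case
      using generate.one[of \<Gamma>] by (simp add: one_\<Gamma>)
  next
    case (Suc m)
    have "unit_vec m [^]\<^bsub>\<Gamma>\<^esub> q \<in> generate \<Gamma> (unit_vec ` {..<n})" for q :: nat
    proof (induction q)
      case 0
      show ?case
        using generate.one[of \<Gamma>] by simp
    next
      case (Suc q)
      then show ?case
        using \<open>Suc m \<le> n\<close> by (simp add: generate.eng generate.incl)
    qed
    then have "vec (\<lambda>k. if k < m then int (p k) else 0) \<otimes>\<^bsub>\<Gamma>\<^esub> unit_vec m [^]\<^bsub>\<Gamma>\<^esub> p m \<in> generate \<Gamma> (unit_vec ` {..<n})"
      using Suc by (intro generate.eng) auto
    moreover have "vec (\<lambda>k. if k < m then int (p k) else 0) \<otimes>\<^bsub>\<Gamma>\<^esub> unit_vec m [^]\<^bsub>\<Gamma>\<^esub> p m =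
        vec (\<lambda>k. if k < Suc m then int (p k) else 0)"
      unfolding unit_vec_def vec_pow vec_mult by (intro arg_cong[where f = vec]) (auto simp: less_Suc_eq)
    ultimately show ?case
      by simp
  qed
  from this[of n] have all: "vec (\<lambda>k. if k < n then int (p k) else 0) \<in> generate \<Gamma> (unit_vec ` {..<n})" for p :: "nat \<Rightarrow> nat"
    by simp
  show "carrier \<Gamma> \<subseteq> generate \<Gamma> (unit_vec ` {..<n})"
  proof
    fix x assume x: "x \<in> carrier \<Gamma>"
    have "vec (\<lambda>k. if k < n then int (nat (x k)) else 0) = vec x"
      using x by (auto simp: vec_eq_iff carrier_\<Gamma>)
    then show "x \<in> generate \<Gamma> (unit_vec ` {..<n})"
      using all[of "\<lambda>k. nat (x k)"] vec_self[OF x] by simp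
  qed
qed

lemma group_rank_\<Gamma>: "group_rank \<Gamma> = n"
  unfolding group_rank_def
proof (rule Least_equality)
  have "inj_on unit_vec {..<n}"
  proof (rule inj_onI)
    fix i j assume "i \<in> {..<n}" "j \<in> {..<n}" "unit_vec i = unit_vec j"
    then have "(if i = i then 1 else 0) mod 2 ^ (b i + 1) = (if i = j then 1 else 0) mod (2::int) ^ (b i + 1)"
      by (auto simp: unit_vec_def vec_eq_iff)
    moreover have "(1::int) mod 2 ^ (b i + 1) = 1"
      using one_less_power[of "2::int" "b i + 1"] by (intro mod_pos_pos_trivial) auto
    ultimately show "i = j"
      by (auto split: if_splits)
  qed
  then have "card (unit_vec ` {..<n}) = n"
    by (simp add: card_image)
  then show "\<exists>S\<subseteq>carrier \<Gamma>. finite S \<and> card S = n \<and> generate \<Gamma> S = carrier \<Gamma>"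
    using generate_units by (intro exI[of _ "unit_vec ` {..<n}"] conjI) (simp_all add: unit_vec_def image_subset_iff)
qed (use card_generators_ge in blast)

definition socle :: "(nat \<Rightarrow> int) set" where
  "socle = {x \<in> carrier \<Gamma>. \<forall>k<n. 2 ^ b k dvd x k}"

definition character :: "nat set \<Rightarrow> (nat \<Rightarrow> int) \<Rightarrow> bool" where
  "character u x \<longleftrightarrow> odd (\<Sum>k\<in>u. x k div 2 ^ b k)"

lemma vec_socle: "vec z \<in> socle \<longleftrightarrow> (\<forall>k<n. 2 ^ b k dvd z k)"
proof -
  have "(2::int) ^ b k dvd z k mod 2 ^ (b k + 1) \<longleftrightarrow> 2 ^ b k dvd z k" for k
    by (rule dvd_mod_iff) (simp add: le_imp_power_dvd)
  then show ?thesis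
    by (simp add: socle_def vec_apply)
qed

lemma socle_eq: "socle = (\<Pi>\<^sub>E k\<in>{..<n}. {0, 2 ^ b k})"
proof -
  have "0 \<le> y \<and> y < 2 ^ (m + 1) \<and> 2 ^ m dvd y \<longleftrightarrow> y \<in> {0, 2 ^ m}" for y :: int and m :: nat
  proof
    assume y: "0 \<le> y \<and> y < 2 ^ (m + 1) \<and> 2 ^ m dvd y"
    then obtain q where q: "y = 2 ^ m * q"
      by blast
    with y have "0 \<le> q" "q < 2"
      by (auto simp: zero_le_mult_iff)
    then have "q = 0 \<or> q = 1"
      by auto
    with q show "y \<in> {0, 2 ^ m}"
      by auto
  qed auto
  note coord = this
  show ?thesis
  proof (rule Set.set_eqI)
    fix x :: "nat \<Rightarrow> int"
    show "x \<in> socle \<longleftrightarrow> x \<in> (\<Pi>\<^sub>E k\<in>{..<n}. {0, 2 ^ b k})"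
      unfolding socle_def carrier_\<Gamma> PiE_iff mem_Collect_eq atLeastLessThan_iff
      using coord by (metis lessThan_iff)
  qed
qed

lemma socle_cases: "\<lbrakk>x \<in> socle; k < n\<rbrakk> \<Longrightarrow> x k = 0 \<or> x k = 2 ^ b k"
  unfolding socle_eq by (auto simp: PiE_iff)

lemma subgroup_socle: "subgroup socle \<Gamma>"
proof (rule \<Gamma>.subgroupI)
  have vec: "x \<in> socle \<Longrightarrow> vec x = x" for x
    by (simp add: socle_def vec_self)
  show "socle \<subseteq> carrier \<Gamma>"
    by (auto simp: socle_def)
  have "vec (\<lambda>k. 0) \<in> socle"
    by (simp add: vec_socle)
  then show "socle \<noteq> {}"
    by blast
  show "inv\<^bsub>\<Gamma>\<^esub> x \<in> socle" if "x \<in> socle" for x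
    using vec_inv[of x] vec_socle[of x] vec_socle[of "\<lambda>k. - x k"] vec that by simp
  show "x \<otimes>\<^bsub>\<Gamma>\<^esub> y \<in> socle" if "x \<in> socle" "y \<in> socle" for x y
    using vec_mult[of x y] vec_socle[of x] vec_socle[of y] vec_socle[of "\<lambda>k. x k + y k"] vec that
    by simp
qed

lemma card_socle: "card socle = 2 ^ n"
proof -
  have "card {0, (2::int) ^ b k} = 2" for k
    by simp
  then show ?thesis
    unfolding socle_eq by (simp add: card_PiE numeral_2_eq_2)
qed

lemma character_mult:
  assumes u: "u \<subseteq> {..<n}" and xy: "x \<in> socle" "y \<in> socle"
  shows "character u (x \<otimes>\<^bsub>\<Gamma>\<^esub> y) \<longleftrightarrow> (character u x \<noteq> character u y)"
proof -
  have eq: "x \<otimes>\<^bsub>\<Gamma>\<^esub> y = vec (\<lambda>k. x k + y k)"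
    using vec_mult[of x y] xy by (simp add: vec_self socle_def)
  have "(x \<otimes>\<^bsub>\<Gamma>\<^esub> y) k div 2 ^ b k = (x k div 2 ^ b k + y k div 2 ^ b k) mod 2" if "k \<in> u" for k
  proof -
    have "k < n"
      using that u by auto
    then show ?thesis
      using socle_cases[OF xy(1) \<open>k < n\<close>] socle_cases[OF xy(2) \<open>k < n\<close>] unfolding eq
      by (elim disjE) (simp_all add: vec_apply)
  qed
  then have "(\<Sum>k\<in>u. (x \<otimes>\<^bsub>\<Gamma>\<^esub> y) k div 2 ^ b k) mod 2 = (\<Sum>k\<in>u. x k div 2 ^ b k + y k div 2 ^ b k) mod 2"
    by (simp add: mod_sum_eq)
  then have "odd (\<Sum>k\<in>u. (x \<otimes>\<^bsub>\<Gamma>\<^esub> y) k div 2 ^ b k) \<longleftrightarrow>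
      odd ((\<Sum>k\<in>u. x k div 2 ^ b k) + (\<Sum>k\<in>u. y k div 2 ^ b k))"
    unfolding sum.distrib by presburger
  then show ?thesis
    unfolding character_def by simp
qed

definition socle_unit :: "nat \<Rightarrow> nat \<Rightarrow> int" where
  "socle_unit j = vec (\<lambda>k. if k = j then 2 ^ b j else 0)"

lemma socle_unit_socle: "socle_unit j \<in> socle"
  by (simp add: socle_unit_def vec_socle)

lemma character_socle_unit:
  assumes "u \<subseteq> {..<n}"
  shows "character u (socle_unit j) \<longleftrightarrow> j \<in> u"
proof -
  have "(\<Sum>k\<in>u. socle_unit j k div 2 ^ b k) = (\<Sum>k\<in>u. if k = j then 1 else 0)"
    using assms by (intro sum.cong) (auto simp: socle_unit_def vec_apply)
  also have "\<dots> = (if j \<in> u then 1 else 0)"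
    using finite_subset[OF assms] by simp
  finally show ?thesis
    by (simp add: character_def)
qed

text \<open>
  If \<open>x\<close> is nonzero in coordinate \<open>j\<close>, adding or removing \<open>j\<close> pairs the subsets with trivial
  character value on \<open>x\<close> with the others.  The empty set, the trivial character, is not an index.
\<close>
lemma card_character_kernels:
  assumes x: "x \<in> socle" "x \<noteq> \<one>\<^bsub>\<Gamma>\<^esub>" and n: "n = Suc m"
  shows "card {u \<in> Pow {..<n} - {{}}. \<not> character u x} = 2 ^ m - 1"
proof -
  have "vec x = x"
    using x(1) by (simp add: socle_def vec_self)
  then obtain j where j: "j < n" "x j \<noteq> 0"
    using x(2) vec_eq_iff[of x "\<lambda>k. 0"] unfolding one_\<Gamma> by (metis mod_0)
  then have xj: "x j div 2 ^ b j = 1"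
    using socle_cases[OF x(1) j(1)] by simp
  have toggle: "character (insert j u) x \<longleftrightarrow> \<not> character u x" if "u \<subseteq> {..<n}" "j \<notin> u" for u
    using that finite_subset[OF that(1)] by (simp add: character_def xj)
  define F where "F = (\<lambda>u. if j \<in> u then u - {j} else insert j u)"
  have char_F: "character (F u) x \<longleftrightarrow> \<not> character u x" if "u \<subseteq> {..<n}" for u
  proof (cases "j \<in> u")
    case True
    then show ?thesis
      using toggle[of "u - {j}"] that by (auto simp: F_def insert_absorb)
  next
    case False
    then show ?thesis
      using toggle[of u] that by (simp add: F_def)
  qed
  have F: "F (F u) = u" "u \<subseteq> {..<n} \<Longrightarrow> F u \<subseteq> {..<n}" for u
    using j(1) by (auto simp: F_def)
  have "bij_betw F {u \<in> Pow {..<n}. \<not> character u x} {u \<in> Pow {..<n}. character u x}"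
    using char_F F by (intro bij_betw_byWitness[where f' = F]) (simp_all add: image_subset_iff)
  then have "card {u \<in> Pow {..<n}. \<not> character u x} = card {u \<in> Pow {..<n}. character u x}"
    by (rule bij_betw_same_card)
  moreover have "card {u \<in> Pow {..<n}. \<not> character u x} + card {u \<in> Pow {..<n}. character u x} = card (Pow {..<n})"
    by (subst card_Un_disjoint[symmetric]) (auto intro: arg_cong[where f = card])
  ultimately have "card {u \<in> Pow {..<n}. \<not> character u x} = 2 ^ m"
    by (simp add: card_Pow n)
  moreover have "{u \<in> Pow {..<n} - {{}}. \<not> character u x} = {u \<in> Pow {..<n}. \<not> character u x} - {{}}"
    by blast
  moreover have "{} \<in> {u \<in> Pow {..<n}. \<not> character u x}"
    by (simp add: character_def)
  ultimately show ?thesis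
    by simp
qed

lemma hyperplane_family_\<Gamma>:
  assumes "1 \<le> d" "n = d + 1" "(\<Sum>k<n. b k) = n"
  shows "hyperplane_family \<Gamma> socle (Pow {..<n} - {{}}) character d"
proof (intro hyperplane_family.intro hyperplane_family_axioms.intro)
  show "order \<Gamma> = 2 ^ (2 * d + 2)"
    unfolding order_\<Gamma> assms(3) by (simp add: assms(2) mult_2)
  show "card socle = 2 ^ (d + 1)"
    by (subst card_socle) (simp add: assms(2))
  show "card (Pow {..<n} - {{}}) = 2 ^ (d + 1) - 1"
    by (simp add: card_Pow assms(2))
  show "\<exists>t\<in>socle. character u t" if "u \<in> Pow {..<n} - {{}}" for u
  proof -
    obtain j where "j \<in> u"
      using \<open>u \<in> _\<close> by blast
    then show ?thesis
      using \<open>u \<in> _\<close> character_socle_unit socle_unit_socle by blast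
  qed
  show "\<exists>t\<in>socle. \<not> character u t \<and> character v t"
    if uv: "u \<in> Pow {..<n} - {{}}" "v \<in> Pow {..<n} - {{}}" "u \<noteq> v" for u v
  proof (cases "v \<subseteq> u")
    case False
    then obtain j where "j \<in> v" "j \<notin> u"
      by blast
    then show ?thesis
      using uv character_socle_unit socle_unit_socle by blast
  next
    case True
    obtain i j where ij: "i \<in> v" "j \<in> u" "j \<notin> v"
      using True uv by blast
    let ?t = "socle_unit i \<otimes>\<^bsub>\<Gamma>\<^esub> socle_unit j"
    have "\<not> character u ?t" "character v ?t"
      using character_mult[OF _ socle_unit_socle socle_unit_socle] character_socle_unit uv ij True by auto
    moreover have "?t \<in> socle"
      using subgroup.m_closed[OF subgroup_socle] socle_unit_socle by blast
    ultimately show ?thesis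
      by blast
  qed
  show "card {u \<in> Pow {..<n} - {{}}. \<not> character u x} = 2 ^ d - 1" if "x \<in> socle" "x \<noteq> \<one>\<^bsub>\<Gamma>\<^esub>" for x
    using card_character_kernels[OF that] assms(2) by simp
qed (use assms(1) comm_group_\<Gamma> subgroup_socle character_mult in auto)

definition signed_row :: "(nat \<Rightarrow> nat \<Rightarrow> nat \<Rightarrow> int) \<Rightarrow> (nat \<Rightarrow> int) \<Rightarrow> nat set \<Rightarrow> nat \<Rightarrow> int" where
  "signed_row A c u = vec (\<lambda>k. \<Sum>i<3. \<Sum>j<n. c i * of_bool (j \<in> u) * A i j k)"

lemma signed_row_quotient:
  "signed_row A c u \<otimes>\<^bsub>\<Gamma>\<^esub> inv\<^bsub>\<Gamma>\<^esub> signed_row A c' u = signed_row A (\<lambda>i. c i - c' i) u"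
  unfolding signed_row_def vec_inv vec_mult
  by (rule arg_cong[where f = vec]) (simp add: sum_subtractf left_diff_distrib)

text \<open>
  Both requirements on a transversal ask that a certain signed combination of the columns is not in the
  socle: the indicator vector of \<open>u\<close> for the first, the difference of two indicator vectors for the
  second.
\<close>
lemma transversal_signed_row:
  assumes "hyperplane_family \<Gamma> socle (Pow {..<n} - {{}}) character d"
    and b: "\<And>k. n \<le> k \<Longrightarrow> b k = 0"
    and A: "zero_free n b A"
    and c: "\<And>i. i < 3 \<Longrightarrow> c i \<in> {-1, 0, 1}" "\<exists>i<3. c i \<noteq> 0"
  shows "hyperplane_family.transversal \<Gamma> socle (Pow {..<n} - {{}}) (signed_row A c)"
proof -
  interpret hyperplane_family \<Gamma> socle "Pow {..<n} - {{}}" character d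
    by fact
  have zero: "\<forall>j<n. \<delta> j = 0"
    if "\<And>j. j < n \<Longrightarrow> \<delta> j \<in> {-1, 0, 1}" "vec (\<lambda>k. \<Sum>i<3. \<Sum>j<n. c i * \<delta> j * A i j k) \<in> socle" for \<delta>
  proof (rule zero_freeD[OF A c that(1)])
    show "2 ^ b k dvd (\<Sum>i<3. \<Sum>j<n. c i * \<delta> j * A i j k)" for k
      using that(2) b[of k] unfolding vec_socle by (cases "k < n") auto
  qed
  show ?thesis
    unfolding transversal_def
  proof (intro conjI ballI impI)
    fix u assume u: "u \<in> Pow {..<n} - {{}}"
    show "signed_row A c u \<in> carrier \<Gamma>"
      by (simp add: signed_row_def)
    show "signed_row A c u \<notin> socle"
    proof
      assume "signed_row A c u \<in> socle"
      then have "\<forall>j<n. of_bool (j \<in> u) = (0::int)"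
        unfolding signed_row_def by (intro zero) auto
      then show False
        using u by auto
    qed
    fix v assume v: "v \<in> Pow {..<n} - {{}}"
      and E: "inv\<^bsub>\<Gamma>\<^esub> signed_row A c u \<otimes>\<^bsub>\<Gamma>\<^esub> signed_row A c v \<in> socle"
    have "inv\<^bsub>\<Gamma>\<^esub> signed_row A c u \<otimes>\<^bsub>\<Gamma>\<^esub> signed_row A c v =
        vec (\<lambda>k. \<Sum>i<3. \<Sum>j<n. c i * (of_bool (j \<in> v) - of_bool (j \<in> u)) * A i j k)"
      unfolding signed_row_def vec_inv vec_mult
      by (rule arg_cong[where f = vec])
        (simp add: sum_subtractf left_diff_distrib right_diff_distrib)
    with E have "\<forall>j<n. of_bool (j \<in> v) - of_bool (j \<in> u) = (0::int)"
      by (intro zero) auto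
    then show "u = v"
      using u v by (auto split: if_splits)
  qed
qed

text \<open>
  The seven members are indexed by the nonempty sets of rows.  The quotient of the transversals for two
  such sets has as coefficients the difference of their indicator vectors, which is again a nonzero
  sign vector.
\<close>
lemma reduced_linking_system_\<Gamma>:
  assumes "1 \<le> d" "n = d + 1" "(\<Sum>k<n. b k) = n" "\<And>k. n \<le> k \<Longrightarrow> b k = 0" "zero_free n b A"
  shows "\<exists>R. reduced_linking_system \<Gamma> (2 ^ (2 * d + 2)) (2 ^ d * (2 ^ (d + 1) - 1))
    (2 ^ d * (2 ^ d - 1)) (2 ^ (2 * d)) 7 R"
proof -
  note family = hyperplane_family_\<Gamma>[OF assms(1-3)]
  interpret hyperplane_family \<Gamma> socle "Pow {..<n} - {{}}" character d
    by (rule family)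
  let ?T = "Pow {..<3::nat} - {{}}"
  let ?ind = "\<lambda>\<epsilon> i. of_bool (i \<in> \<epsilon>) :: int"
  have T: "finite ?T" "card ?T = 7"
    by (simp_all add: card_Pow)
  have single: "transversal (signed_row A (?ind \<epsilon>))" if "\<epsilon> \<in> ?T" for \<epsilon>
    using that by (intro transversal_signed_row[OF family assms(4,5)]) auto
  have quotient: "transversal (\<lambda>u. signed_row A (?ind \<epsilon>) u \<otimes>\<^bsub>\<Gamma>\<^esub> inv\<^bsub>\<Gamma>\<^esub> signed_row A (?ind \<eta>) u)"
    if "\<epsilon> \<in> ?T" "\<eta> \<in> ?T" "\<epsilon> \<noteq> \<eta>" for \<epsilon> \<eta>
    unfolding signed_row_quotient using that
    by (intro transversal_signed_row[OF family assms(4,5)]) auto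
  show ?thesis
    using reduced_linking_system_coset_unions[of ?T "\<lambda>\<epsilon>. signed_row A (?ind \<epsilon>)"] T single quotient
    by auto
qed

end

section \<open>Linking systems of size seven\<close>

theorem corollary6p4:
  fixes d e :: nat
  assumes "2 \<le> d"
    and "2 \<le> e"
    and "real e \<le> (real d + 3) / 2"
  shows "\<exists>G :: (nat \<Rightarrow> int) monoid.
           comm_group G \<and> finite (carrier G) \<and> order G = 2 ^ (2 * d + 2) \<and>
           group_rank G = d + 1 \<and> group_exponent G = 2 ^ e \<and>
           (\<exists>R. reduced_linking_system G
                  (2 ^ (2 * d + 2))
                  (2 ^ d * (2 ^ (d + 1) - 1))
                  (2 ^ d * (2 ^ d - 1))
                  (2 ^ (2 * d))
                  7 R)"
proof -
  have "admissible (d + 1) (e - 1)"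
  proof (rule admissible_if_twice_le)
    have "real (2 * e) \<le> real (d + 3)"
      using assms(3) by simp
    then have "2 * e \<le> d + 3"
      by (simp only: of_nat_le_iff)
    then show "2 * (e - 1) \<le> d + 1"
      by simp
  qed (use assms in auto)
  then obtain b A where b: "(\<Sum>k<d + 1. b k) = d + 1" "\<And>k. d + 1 \<le> k \<Longrightarrow> b k = 0"
      "\<And>k. b k \<le> e - 1" "b 0 = e - 1" and A: "zero_free (d + 1) b A"
    unfolding admissible_def by blast
  interpret residue_vectors "d + 1" b .
  have "order \<Gamma> = 2 ^ (2 * d + 2)"
    unfolding order_\<Gamma> b(1) by (simp add: mult_2)
  moreover have "group_exponent \<Gamma> = 2 ^ e"
    using group_exponent_\<Gamma>[of 0] b(3,4) assms(2) by simp
  moreover have "\<exists>R. reduced_linking_system \<Gamma> (2 ^ (2 * d + 2)) (2 ^ d * (2 ^ (d + 1) - 1))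
      (2 ^ d * (2 ^ d - 1)) (2 ^ (2 * d)) 7 R"
    using assms(1) by (intro reduced_linking_system_\<Gamma>[OF _ refl b(1) b(2) A]) auto
  ultimately show ?thesis
    using comm_group_\<Gamma> finite_\<Gamma> group_rank_\<Gamma> by (intro exI[of _ \<Gamma>]) simp
qed

end
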